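(* Let $(\overline M,\overline\varphi,\overline\xi,\overline\eta,\overline g,\overline{\widetilde g})$ be a $(2n+1)$-dimensional almost contact B-metric manifold with associated metric $\overline{\widetilde g}$, and let $(M,g,S(TM),{\rm Rad}(TM))$ be an ascreen radical screen transversal half lightlike submanifold of $(\overline M,\overline g)$. Let $\widetilde g$ be the metric induced on $M$ by $\overline{\widetilde g}$, and let $\xi, N, L,\mu$ be as in the context. Then: (i) $(M,\widetilde g)$ is a semi-Riemannian submanifold of $(\overline M,\overline{\widetilde g})$ of codimension two, and the vector fields $N_1=\overline\xi-L$, $N_2=2\overline\xi-2\mu N-L$ form an orthonormal basis with respect to $\overline{\widetilde g}$ of the normal bundle $TM^{\widetilde\bot}$ of $(M,\widetilde g)$ in $(\overline M,\overline{\widetilde g})$ such that $$\overline{\widetilde g}(N_1,N_1)=-\overline{\widetilde g}(N_2,N_2)=1,\qquad \overline{\widetilde g}(N_1,N_2)=0.$$ (ii) The tangent bundle $TM$ of $(M,\widetilde g)$ is an orthogonal direct sum with respect to $\widetilde g$ of the distributions $S(TM)$ and ${\rm Rad}(TM)$. Moreover, both $S(TM)$ and ${\rm Rad}(TM)$ are non-degenerate with respect to $\widetilde g$, ${\rm Rad}(TM)$ is spacelike (with respect to $\widetilde g$), and the signature of $\widetilde g$ on $S(TM)$ is $(n-1,n-1)$.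
   Context: Almost contact B-metric manifold: a $(2n+1)$-dimensional smooth manifold $\overline M$ with an endomorphism $\overline\varphi$ of $T\overline M$, a vector field $\overline\xi$, a 1-form $\overline\eta$ and a semi-Riemannian metric $\overline g$ such that $\overline\varphi^2X=-X+\overline\eta(X)\overline\xi$, $\overline\eta(\overline\xi)=1$, $\overline g(\overline\varphi X,\overline\varphi Y)=-\overline g(X,Y)+\overline\eta(X)\overline\eta(Y)$. Consequently $\overline\varphi\,\overline\xi=0$, $\overline\eta\circ\overline\varphi=0$, $\overline\eta(X)=\overline g(X,\overline\xi)$, $\overline g(\overline\xi,\overline\xi)=1$. The associated metric is $\overline{\widetilde g}(X,Y)=\overline g(X,\overline\varphi Y)+\overline\eta(X)\overline\eta(Y)$. Both $\overline g$ and $\overline{\widetilde g}$ have signature $(n+1,n)$, where signature $(p,q)$ means $p$ plus signs and $q$ minus signs. Half lightlike submanifold: a submanifold $M$ of codimension 2 of $(\overline M,\overline g)$, with induced (degenerate) metric $g$, such that ${\rm Rad}(TM)=TM\cap TM^\bot$ has constant rank 1, where $TM^\bot$ is the normal bundle with respect to $\overline g$. One fixes non-degenerate distributions $S(TM)$ (screen distribution) and $S(TM^\bot)$ (screen transversal bundle, of rank 1) with $TM={\rm Rad}(TM)\bot S(TM)$ and $TM^\bot={\rm Rad}(TM)\bot S(TM^\bot)$ (orthogonal direct sums with respect to $\overline g$). Locally, $L$ denotes a unit vector field spanning $S(TM^\bot)$ ($\overline g(L,L)=\pm1$), $\xi$ a nowhere zero section of ${\rm Rad}(TM)$, and $N$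 the unique local vector field with $\overline g(N,\xi)=1$, $\overline g(N,N)=\overline g(N,L)=\overline g(N,X)=0$ for all $X\in\Gamma(S(TM))$. The lightlike transversal bundle is ${\rm ltr}(TM)={\rm span}\{N\}$, and $T\overline M|_M=\{{\rm Rad}(TM)\oplus{\rm ltr}(TM)\}\bot S(TM)\bot S(TM^\bot)$. $M$ is a radical screen transversal half lightlike (RSTHL) submanifold if $\overline\varphi({\rm Rad}(TM))=S(TM^\bot)$; it is ascreen if $\overline\xi$ (along $M$) belongs to ${\rm Rad}(TM)\oplus{\rm ltr}(TM)$. The function $\mu$: by the RSTHL condition $\overline\varphi\xi=\mu L$ with $\mu$ a non-zero smooth function on $M$. One has $\overline\eta(\xi)=\pm\mu$, and $L$ is chosen (replacing $L$ by $-L$ if necessary) so that $\overline\eta(\xi)=\mu$. *)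

theory Defs
  imports "HOL-Analysis.Analysis"
begin

section \<open>Smooth manifolds\<close>

text \<open>
  \<open>C\<^sup>k\<close> and \<open>C\<^sup>\<infinity>\<close> maps on an open subset of a Euclidean space; the predicates are only
  meant to be used for open sets.
\<close>

fun Ck_on :: "nat \<Rightarrow> 'a::euclidean_space set \<Rightarrow> ('a \<Rightarrow> 'b::real_normed_vector) \<Rightarrow> bool" where
  "Ck_on 0 S f \<longleftrightarrow> continuous_on S f"
| "Ck_on (Suc k) S f \<longleftrightarrow>
     (\<forall>x\<in>S. f differentiable (at x)) \<and> (\<forall>v. Ck_on k S (\<lambda>x. frechet_derivative f (at x) v))"

definition smooth_on :: "'a::euclidean_space set \<Rightarrow> ('a \<Rightarrow> 'b::real_normed_vector) \<Rightarrow> bool" where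
  "smooth_on S f \<longleftrightarrow> (\<forall>k. Ck_on k S f)"

text \<open>
  The points of a manifold are the elements of a type, the model space is a Euclidean space
  \<open>'e\<close>, and the dimension of the manifold is \<open>DIM('e)\<close>. A chart is a pair of its domain and its
  coordinate map; the values of the coordinate map outside the domain are irrelevant.
\<close>

type_synonym ('m, 'e) chart = "'m set \<times> ('m \<Rightarrow> 'e)"

definition chart_inv :: "('m, 'e) chart \<Rightarrow> 'e \<Rightarrow> 'm" where
  "chart_inv c = inv_into (fst c) (snd c)"

definition is_chart :: "('m::topological_space, 'e::euclidean_space) chart \<Rightarrow> bool" where
  "is_chart c \<longleftrightarrow> open (fst c) \<and> open (snd c ` fst c) \<and>
     homeomorphism (fst c) (snd c ` fst c) (snd c) (chart_inv c)"

definition smooth_atlas ::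
  "('m::{t2_space,second_countable_topology}, 'e::euclidean_space) chart set \<Rightarrow> bool" where
  "smooth_atlas A \<longleftrightarrow> (\<forall>c\<in>A. is_chart c) \<and> (\<Union>c\<in>A. fst c) = UNIV \<and>
     (\<forall>c\<in>A. \<forall>d\<in>A. smooth_on (snd c ` (fst c \<inter> fst d)) (snd d \<circ> chart_inv c))"

text \<open>
  The tangent space at \<open>p\<close> is the model space \<open>'e\<close>: a tangent vector at \<open>p\<close> is represented by its
  components in the chart \<open>chart_at A p\<close>, an arbitrary but fixed chart of the atlas around \<open>p\<close>.
  Since \<open>chart_at A p\<close> need not depend continuously on \<open>p\<close>, smoothness of fields is always
  expressed through components in a fixed chart \<open>c\<close>. To this end \<open>tan_coord A c p\<close> maps a tangent
  vector at \<open>p\<close> to its components in \<open>c\<close>, and \<open>tan_vec A c p\<close> maps components in \<open>c\<close> to the tangent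
  vector at \<open>p\<close> (for \<open>p\<close> in the domain of \<open>c\<close>); both are differentials of transition maps.
\<close>

definition chart_at :: "('m, 'e) chart set \<Rightarrow> 'm \<Rightarrow> ('m, 'e) chart" where
  "chart_at A p = (SOME c. c \<in> A \<and> p \<in> fst c)"

definition tan_coord ::
  "('m, 'e::euclidean_space) chart set \<Rightarrow> ('m, 'e) chart \<Rightarrow> 'm \<Rightarrow> 'e \<Rightarrow> 'e" where
  "tan_coord A c p =
     frechet_derivative (snd c \<circ> chart_inv (chart_at A p)) (at (snd (chart_at A p) p))"

definition tan_vec ::
  "('m, 'e::euclidean_space) chart set \<Rightarrow> ('m, 'e) chart \<Rightarrow> 'm \<Rightarrow> 'e \<Rightarrow> 'e" where
  "tan_vec A c p = frechet_derivative (snd (chart_at A p) \<circ> chart_inv c) (at (snd c p))"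

definition smooth_scalar_on ::
  "('m, 'e::euclidean_space) chart set \<Rightarrow> 'm set \<Rightarrow> ('m \<Rightarrow> real) \<Rightarrow> bool" where
  "smooth_scalar_on A U h \<longleftrightarrow> (\<forall>c\<in>A. smooth_on (snd c ` (fst c \<inter> U)) (h \<circ> chart_inv c))"

definition smooth_map ::
  "('k::topological_space, 'd::euclidean_space) chart set \<Rightarrow>
   ('m::topological_space, 'e::euclidean_space) chart set \<Rightarrow> ('k \<Rightarrow> 'm) \<Rightarrow> bool" where
  "smooth_map A B f \<longleftrightarrow> continuous_on UNIV f \<and>
     (\<forall>c\<in>A. \<forall>d\<in>B. smooth_on (snd c ` (fst c \<inter> f -` fst d)) (snd d \<circ> f \<circ> chart_inv c))"

text \<open>The differential of a map at a point.\<close>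

definition tangent_map ::
  "('k, 'd::euclidean_space) chart set \<Rightarrow> ('m, 'e::euclidean_space) chart set \<Rightarrow>
   ('k \<Rightarrow> 'm) \<Rightarrow> 'k \<Rightarrow> 'd \<Rightarrow> 'e" where
  "tangent_map A B f p =
     frechet_derivative (snd (chart_at B (f p)) \<circ> f \<circ> chart_inv (chart_at A p))
       (at (snd (chart_at A p) p))"

text \<open>
  A vector field along \<open>f\<close> on \<open>U\<close> assigns to \<open>p \<in> U\<close> a tangent vector at \<open>f p\<close>, i.e. it is a section
  of the pulled back tangent bundle. Vector fields on a manifold are the case \<open>f = id\<close>.
\<close>

definition smooth_field_along ::
  "('k, 'd::euclidean_space) chart set \<Rightarrow> ('m, 'e::euclidean_space) chart set \<Rightarrow>
   ('k \<Rightarrow> 'm) \<Rightarrow> 'k set \<Rightarrow> ('k \<Rightarrow> 'e) \<Rightarrow> bool" where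
  "smooth_field_along A B f U X \<longleftrightarrow>
     (\<forall>c\<in>A. \<forall>d\<in>B. smooth_on (snd c ` (fst c \<inter> U \<inter> f -` fst d))
        ((\<lambda>p. tan_coord B d (f p) (X p)) \<circ> chart_inv c))"

definition smooth_vector_field_on ::
  "('m, 'e::euclidean_space) chart set \<Rightarrow> 'm set \<Rightarrow> ('m \<Rightarrow> 'e) \<Rightarrow> bool" where
  "smooth_vector_field_on A U X \<longleftrightarrow> smooth_field_along A A id U X"

text \<open>Tensor fields are smooth if their values on the coordinate fields of every chart are.\<close>

definition smooth_one_form ::
  "('m, 'e::euclidean_space) chart set \<Rightarrow> ('m \<Rightarrow> 'e \<Rightarrow> real) \<Rightarrow> bool" where
  "smooth_one_form A \<eta> \<longleftrightarrow> (\<forall>p. linear (\<eta> p)) \<and>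
     (\<forall>c\<in>A. \<forall>v. smooth_scalar_on A (fst c) (\<lambda>p. \<eta> p (tan_vec A c p v)))"

definition smooth_endomorphism ::
  "('m, 'e::euclidean_space) chart set \<Rightarrow> ('m \<Rightarrow> 'e \<Rightarrow> 'e) \<Rightarrow> bool" where
  "smooth_endomorphism A \<phi> \<longleftrightarrow> (\<forall>p. linear (\<phi> p)) \<and>
     (\<forall>c\<in>A. \<forall>v. smooth_vector_field_on A (fst c) (\<lambda>p. \<phi> p (tan_vec A c p v)))"

definition smooth_bilinear_form ::
  "('m, 'e::euclidean_space) chart set \<Rightarrow> ('m \<Rightarrow> 'e \<Rightarrow> 'e \<Rightarrow> real) \<Rightarrow> bool" where
  "smooth_bilinear_form A g \<longleftrightarrow> (\<forall>p. bilinear (g p)) \<and>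
     (\<forall>c\<in>A. \<forall>v w. smooth_scalar_on A (fst c) (\<lambda>p. g p (tan_vec A c p v) (tan_vec A c p w)))"

section \<open>Scalar products and semi-Riemannian metrics\<close>

definition nondegenerate_on :: "('e \<Rightarrow> 'e \<Rightarrow> real) \<Rightarrow> 'e::real_vector set \<Rightarrow> bool" where
  "nondegenerate_on b V \<longleftrightarrow> (\<forall>x\<in>V. (\<forall>y\<in>V. b x y = 0) \<longrightarrow> x = 0)"

text \<open>Signature \<open>(r, s)\<close>: there is an orthonormal basis with \<open>r\<close> plus and \<open>s\<close> minus signs.\<close>

definition has_signature ::
  "('e \<Rightarrow> 'e \<Rightarrow> real) \<Rightarrow> 'e::real_vector set \<Rightarrow> nat \<Rightarrow> nat \<Rightarrow> bool" where
  "has_signature b V r s \<longleftrightarrow>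
     (\<exists>P Q. finite P \<and> finite Q \<and> P \<inter> Q = {} \<and> card P = r \<and> card Q = s \<and>
        independent (P \<union> Q) \<and> span (P \<union> Q) = V \<and>
        (\<forall>x\<in>P. b x x = 1) \<and> (\<forall>x\<in>Q. b x x = -1) \<and>
        (\<forall>x\<in>P \<union> Q. \<forall>y\<in>P \<union> Q. x \<noteq> y \<longrightarrow> b x y = 0))"

definition orthogonal_direct_sum ::
  "('e \<Rightarrow> 'e \<Rightarrow> real) \<Rightarrow> 'e::real_vector set \<Rightarrow> 'e set \<Rightarrow> 'e set \<Rightarrow> bool" where
  "orthogonal_direct_sum b V W Z \<longleftrightarrow>
     Z = {v + w | v w. v \<in> V \<and> w \<in> W} \<and> V \<inter> W = {0} \<and> (\<forall>v\<in>V. \<forall>w\<in>W. b v w = 0)"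

definition semi_riemannian_metric ::
  "('m, 'e::euclidean_space) chart set \<Rightarrow> ('m \<Rightarrow> 'e \<Rightarrow> 'e \<Rightarrow> real) \<Rightarrow> bool" where
  "semi_riemannian_metric A g \<longleftrightarrow> smooth_bilinear_form A g \<and>
     (\<forall>p v w. g p v w = g p w v) \<and> (\<forall>p. nondegenerate_on (g p) UNIV) \<and>
     (\<exists>r s. \<forall>p. has_signature (g p) UNIV r s)"

section \<open>Almost contact B-metric manifolds\<close>

definition almost_contact_B_metric ::
  "nat \<Rightarrow> ('m::{t2_space,second_countable_topology}, 'e::euclidean_space) chart set \<Rightarrow>
   ('m \<Rightarrow> 'e \<Rightarrow> 'e) \<Rightarrow> ('m \<Rightarrow> 'e) \<Rightarrow> ('m \<Rightarrow> 'e \<Rightarrow> real) \<Rightarrow>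
   ('m \<Rightarrow> 'e \<Rightarrow> 'e \<Rightarrow> real) \<Rightarrow> bool" where
  "almost_contact_B_metric n B \<phi> \<zeta> \<eta> g \<longleftrightarrow>
     DIM('e) = 2 * n + 1 \<and> smooth_atlas B \<and>
     smooth_endomorphism B \<phi> \<and> smooth_vector_field_on B UNIV \<zeta> \<and> smooth_one_form B \<eta> \<and>
     semi_riemannian_metric B g \<and>
     (\<forall>p X. \<phi> p (\<phi> p X) = - X + \<eta> p X *\<^sub>R \<zeta> p) \<and>
     (\<forall>p. \<eta> p (\<zeta> p) = 1) \<and>
     (\<forall>p X Y. g p (\<phi> p X) (\<phi> p Y) = - g p X Y + \<eta> p X * \<eta> p Y)"

definition associated_metric ::
  "('m \<Rightarrow> 'e \<Rightarrow> 'e) \<Rightarrow> ('m \<Rightarrow> 'e \<Rightarrow> real) \<Rightarrow> ('m \<Rightarrow> 'e \<Rightarrow> 'e \<Rightarrow> real) \<Rightarrow>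
   'm \<Rightarrow> 'e \<Rightarrow> 'e \<Rightarrow> real" where
  "associated_metric \<phi> \<eta> g p X Y = g p X (\<phi> p Y) + \<eta> p X * \<eta> p Y"

section \<open>Submanifolds\<close>

text \<open>
  A submanifold is an injective immersion \<open>f\<close> of a manifold with atlas \<open>A\<close> into a manifold with
  atlas \<open>B\<close>. As usual \<open>T\<^sub>p M\<close> is identified with its image under the differential of \<open>f\<close>, so that
  distributions on the submanifold and normal vectors all live in the tangent space of the ambient
  manifold at \<open>f p\<close>.
\<close>

definition submanifold ::
  "('k::{t2_space,second_countable_topology}, 'd::euclidean_space) chart set \<Rightarrow>
   ('m::{t2_space,second_countable_topology}, 'e::euclidean_space) chart set \<Rightarrow>
   ('k \<Rightarrow> 'm) \<Rightarrow> bool" where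
  "submanifold A B f \<longleftrightarrow> smooth_atlas A \<and> smooth_atlas B \<and> smooth_map A B f \<and> inj f \<and>
     (\<forall>p. inj (tangent_map A B f p))"

definition tangent_space ::
  "('k, 'd::euclidean_space) chart set \<Rightarrow> ('m, 'e::euclidean_space) chart set \<Rightarrow>
   ('k \<Rightarrow> 'm) \<Rightarrow> 'k \<Rightarrow> 'e set" where
  "tangent_space A B f p = range (tangent_map A B f p)"

definition normal_bundle_at ::
  "('k, 'd::euclidean_space) chart set \<Rightarrow> ('m, 'e::euclidean_space) chart set \<Rightarrow>
   ('k \<Rightarrow> 'm) \<Rightarrow> ('m \<Rightarrow> 'e \<Rightarrow> 'e \<Rightarrow> real) \<Rightarrow> 'k \<Rightarrow> 'e set" where
  "normal_bundle_at A B f g p = {v. \<forall>w\<in>tangent_space A B f p. g (f p) v w = 0}"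

definition induced_metric ::
  "('k, 'd::euclidean_space) chart set \<Rightarrow> ('m, 'e::euclidean_space) chart set \<Rightarrow>
   ('k \<Rightarrow> 'm) \<Rightarrow> ('m \<Rightarrow> 'e \<Rightarrow> 'e \<Rightarrow> real) \<Rightarrow> 'k \<Rightarrow> 'd \<Rightarrow> 'd \<Rightarrow> real" where
  "induced_metric A B f g p u v = g (f p) (tangent_map A B f p u) (tangent_map A B f p v)"

definition semi_riemannian_submanifold ::
  "('k::{t2_space,second_countable_topology}, 'd::euclidean_space) chart set \<Rightarrow>
   ('m::{t2_space,second_countable_topology}, 'e::euclidean_space) chart set \<Rightarrow>
   ('k \<Rightarrow> 'm) \<Rightarrow> ('m \<Rightarrow> 'e \<Rightarrow> 'e \<Rightarrow> real) \<Rightarrow> bool" where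
  "semi_riemannian_submanifold A B f g \<longleftrightarrow> submanifold A B f \<and>
     semi_riemannian_metric B g \<and> semi_riemannian_metric A (induced_metric A B f g)"

text \<open>Smooth subbundles of rank \<open>r\<close> of the ambient tangent bundle along \<open>f\<close>.\<close>

definition smooth_subbundle ::
  "('k::topological_space, 'd::euclidean_space) chart set \<Rightarrow>
   ('m, 'e::euclidean_space) chart set \<Rightarrow> ('k \<Rightarrow> 'm) \<Rightarrow> nat \<Rightarrow> ('k \<Rightarrow> 'e set) \<Rightarrow> bool" where
  "smooth_subbundle A B f r D \<longleftrightarrow> (\<forall>p. subspace (D p) \<and> dim (D p) = r) \<and>
     (\<forall>p. \<exists>U X. open U \<and> p \<in> U \<and> (\<forall>i<r. smooth_field_along A B f U (X i)) \<and>
        (\<forall>q\<in>U. D q = span ((\<lambda>i. X i q) ` {..<r})))"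

section \<open>Half lightlike submanifolds\<close>

definition Rad ::
  "('k, 'd::euclidean_space) chart set \<Rightarrow> ('m, 'e::euclidean_space) chart set \<Rightarrow>
   ('k \<Rightarrow> 'm) \<Rightarrow> ('m \<Rightarrow> 'e \<Rightarrow> 'e \<Rightarrow> real) \<Rightarrow> 'k \<Rightarrow> 'e set" where
  "Rad A B f g p = tangent_space A B f p \<inter> normal_bundle_at A B f g p"

text \<open>
  \<open>S\<close> is the screen distribution \<open>S(TM)\<close> and \<open>ST\<close> the screen transversal bundle \<open>S(TM\<^sup>\<bottom>)\<close>.
\<close>

definition half_lightlike ::
  "('k::{t2_space,second_countable_topology}, 'd::euclidean_space) chart set \<Rightarrow>
   ('m::{t2_space,second_countable_topology}, 'e::euclidean_space) chart set \<Rightarrow>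
   ('k \<Rightarrow> 'm) \<Rightarrow> ('m \<Rightarrow> 'e \<Rightarrow> 'e \<Rightarrow> real) \<Rightarrow>
   ('k \<Rightarrow> 'e set) \<Rightarrow> ('k \<Rightarrow> 'e set) \<Rightarrow> bool" where
  "half_lightlike A B f g S ST \<longleftrightarrow>
     submanifold A B f \<and> DIM('e) = DIM('d) + 2 \<and>
     (\<forall>p. dim (Rad A B f g p) = 1) \<and>
     smooth_subbundle A B f (DIM('d) - 1) S \<and> smooth_subbundle A B f 1 ST \<and>
     (\<forall>p. nondegenerate_on (g (f p)) (S p) \<and> nondegenerate_on (g (f p)) (ST p) \<and>
        orthogonal_direct_sum (g (f p)) (Rad A B f g p) (S p) (tangent_space A B f p) \<and>
        orthogonal_direct_sum (g (f p)) (Rad A B f g p) (ST p) (normal_bundle_at A B f g p))"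

text \<open>
  The conditions that determine the vector \<open>N\<close> at a point in terms of \<open>\<xi>\<close>, \<open>L\<close> and the
  screen space \<open>V\<close>.
\<close>

definition null_transversal ::
  "('e \<Rightarrow> 'e \<Rightarrow> real) \<Rightarrow> 'e set \<Rightarrow> 'e \<Rightarrow> 'e \<Rightarrow> 'e \<Rightarrow> bool" where
  "null_transversal b V \<xi> L N \<longleftrightarrow>
     b N \<xi> = 1 \<and> b N N = 0 \<and> b N L = 0 \<and> (\<forall>X\<in>V. b N X = 0)"

text \<open>
  The lightlike transversal bundle \<open>ltr(TM)\<close>. The span runs over the vectors \<open>N\<close> for all admissible
  \<open>\<xi>\<close> and \<open>L\<close>; rescaling \<open>\<xi>\<close> rescales \<open>N\<close>, and \<open>L\<close> is unique up to sign, so this is the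
  line spanned by any one of them.
\<close>

definition ltr ::
  "('k, 'd::euclidean_space) chart set \<Rightarrow> ('m, 'e::euclidean_space) chart set \<Rightarrow>
   ('k \<Rightarrow> 'm) \<Rightarrow> ('m \<Rightarrow> 'e \<Rightarrow> 'e \<Rightarrow> real) \<Rightarrow>
   ('k \<Rightarrow> 'e set) \<Rightarrow> ('k \<Rightarrow> 'e set) \<Rightarrow> 'k \<Rightarrow> 'e set" where
  "ltr A B f g S ST p =
     span {N. \<exists>\<xi>\<in>Rad A B f g p. \<exists>L\<in>ST p. \<xi> \<noteq> 0 \<and> \<bar>g (f p) L L\<bar> = 1 \<and>
                null_transversal (g (f p)) (S p) \<xi> L N}"

text \<open>Here \<open>\<zeta>\<close> is the structure vector field of the ambient manifold (the overlined \<open>\<xi>\<close>).\<close>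

definition radical_screen_transversal ::
  "('k::{t2_space,second_countable_topology}, 'd::euclidean_space) chart set \<Rightarrow>
   ('m::{t2_space,second_countable_topology}, 'e::euclidean_space) chart set \<Rightarrow>
   ('k \<Rightarrow> 'm) \<Rightarrow> ('m \<Rightarrow> 'e \<Rightarrow> 'e) \<Rightarrow> ('m \<Rightarrow> 'e \<Rightarrow> 'e \<Rightarrow> real) \<Rightarrow>
   ('k \<Rightarrow> 'e set) \<Rightarrow> ('k \<Rightarrow> 'e set) \<Rightarrow> bool" where
  "radical_screen_transversal A B f \<phi> g S ST \<longleftrightarrow>
     half_lightlike A B f g S ST \<and> (\<forall>p. \<phi> (f p) ` Rad A B f g p = ST p)"

definition ascreen ::
  "('k, 'd::euclidean_space) chart set \<Rightarrow> ('m, 'e::euclidean_space) chart set \<Rightarrow>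
   ('k \<Rightarrow> 'm) \<Rightarrow> ('m \<Rightarrow> 'e) \<Rightarrow> ('m \<Rightarrow> 'e \<Rightarrow> 'e \<Rightarrow> real) \<Rightarrow>
   ('k \<Rightarrow> 'e set) \<Rightarrow> ('k \<Rightarrow> 'e set) \<Rightarrow> bool" where
  "ascreen A B f \<zeta> g S ST \<longleftrightarrow>
     (\<forall>p. \<exists>u\<in>Rad A B f g p. \<exists>v\<in>ltr A B f g S ST p. \<zeta> (f p) = u + v)"

text \<open>
  Local fields \<open>\<xi>\<close>, \<open>N\<close>, \<open>L\<close> and the function \<open>\<mu>\<close> on an open subset \<open>U\<close> of the submanifold;
  the last condition is the normalisation of the sign of \<open>L\<close>.
\<close>

definition local_fields ::
  "('k::{t2_space,second_countable_topology}, 'd::euclidean_space) chart set \<Rightarrow>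
   ('m::{t2_space,second_countable_topology}, 'e::euclidean_space) chart set \<Rightarrow>
   ('k \<Rightarrow> 'm) \<Rightarrow> ('m \<Rightarrow> 'e \<Rightarrow> 'e) \<Rightarrow> ('m \<Rightarrow> 'e \<Rightarrow> real) \<Rightarrow> ('m \<Rightarrow> 'e \<Rightarrow> 'e \<Rightarrow> real) \<Rightarrow>
   ('k \<Rightarrow> 'e set) \<Rightarrow> ('k \<Rightarrow> 'e set) \<Rightarrow>
   'k set \<Rightarrow> ('k \<Rightarrow> 'e) \<Rightarrow> ('k \<Rightarrow> 'e) \<Rightarrow> ('k \<Rightarrow> 'e) \<Rightarrow> ('k \<Rightarrow> real) \<Rightarrow> bool" where
  "local_fields A B f \<phi> \<eta> g S ST U \<xi> N L \<mu> \<longleftrightarrow> open U \<and>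
     smooth_field_along A B f U \<xi> \<and> smooth_field_along A B f U N \<and>
     smooth_field_along A B f U L \<and> smooth_scalar_on A U \<mu> \<and>
     (\<forall>p\<in>U. \<xi> p \<in> Rad A B f g p \<and> \<xi> p \<noteq> 0 \<and>
        L p \<in> ST p \<and> \<bar>g (f p) (L p) (L p)\<bar> = 1 \<and>
        null_transversal (g (f p)) (S p) (\<xi> p) (L p) (N p) \<and>
        \<phi> (f p) (\<xi> p) = \<mu> p *\<^sub>R L p \<and> \<mu> p \<noteq> 0 \<and> \<eta> (f p) (\<xi> p) = \<mu> p)"

end

theory Submission
  imports Defs
begin

text \<open>
  Apart from smoothness, everything is decided pointwise. The ascreen condition forces \<open>\<zeta> = \<xi> / (2 \<mu>) + \<mu> N\<close>, hence
  \<open>\<phi> L = \<zeta> - \<xi> / \<mu>\<close>, \<open>\<phi> N = - L / (2 \<mu>)\<close> and \<open>N\<^sub>2 = \<xi> / \<mu> - L\<close>, from which all scalar products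
  with respect to the associated metric are read off. Moreover \<open>S(TM)\<close> is the \<open>g\<close>-orthogonal
  complement of \<open>\<xi>\<close>, \<open>N\<close> and \<open>L\<close>, so it is \<open>\<phi>\<close>-invariant and contained in the kernel of \<open>\<eta>\<close>;
  there \<open>\<phi>\<close> is a complex structure that changes the sign of the associated metric, which makes
  the signature neutral. The same argument on the kernel of \<open>\<eta>\<close> gives the signature of the
  ambient associated metric.
\<close>

section \<open>Signatures of bilinear forms\<close>

text \<open>Part (i) is given local fields, but part (ii) speaks of every point and comes with no
  frame. A frame at each point is extracted from the ascreen condition itself: without admissible
  transversal vectors \<open>\<zeta>\<close> would lie in the radical, against
  \<open>g \<zeta> \<zeta> = 1\<close>. The two coefficients of \<open>\<zeta>\<close> are then
  forced: pairing with \<open>\<xi>\<close> gives \<open>\<eta> \<xi> = \<mu>\<close> in front of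
  \<open>N\<close>, and \<open>\<eta> \<zeta> = 1\<close> leaves \<open>1 / (2 * \<mu>)\<close> in
  front of \<open>\<xi>\<close>. The screen has dimension \<open>(2 * n + 1) - 3\<close>, whence the
  \<open>n - 1\<close> in its signature.

  Being semi-Riemannian includes one signature valid at all points. For the submanifold it arises by
  adding the positive radical line to the neutral screen and pulling back along the differential.

  Smoothness is a separate obstacle: tangent vectors are recorded in the chart
  \<open>chart_at A p\<close>, which is chosen without any continuity in \<open>p\<close>. Every
  smoothness claim is therefore transferred to fixed charts by the chain rule.\<close>

lemma bilinear_simps:
  assumes "bilinear b"
  shows "b (x + y) z = b x z + b y z" "b z (x + y) = b z x + b z y"
    "b (x - y) z = b x z - b y z" "b z (x - y) = b z x - b z y"
    "b (- x) z = - b x z" "b z (- x) = - b z x"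
    "b (c *\<^sub>R x) z = c *\<^sub>R b x z" "b z (c *\<^sub>R x) = c *\<^sub>R b z x"
    "b 0 z = 0" "b z 0 = 0"
  by (simp_all add: assms bilinear_ladd bilinear_radd bilinear_lsub bilinear_rsub
      bilinear_lmul bilinear_rmul bilinear_lneg bilinear_rneg bilinear_lzero bilinear_rzero)

lemma bilinear_sum_left: "bilinear b \<Longrightarrow> b (sum F I) z = (\<Sum>i\<in>I. b (F i) z)"
  unfolding bilinear_def by (simp add: linear_sum[of "\<lambda>x. b x z"])

lemma bilinear_sum_right: "bilinear b \<Longrightarrow> b z (sum F I) = (\<Sum>i\<in>I. b z (F i))"
  unfolding bilinear_def by (simp add: linear_sum)

lemma bilinear_pairwise_orthogonal_sum:
  fixes b :: "'e::real_vector \<Rightarrow> 'e \<Rightarrow> real"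
  assumes "bilinear b" "finite I" "v \<in> I" "\<And>x. x \<in> I \<Longrightarrow> x \<noteq> v \<Longrightarrow> b x v = 0"
  shows "b (\<Sum>x\<in>I. u x *\<^sub>R x) v = u v * b v v"
proof -
  have "b (\<Sum>x\<in>I. u x *\<^sub>R x) v = (\<Sum>x\<in>I. u x * b x v)"
    using assms(1) by (simp add: bilinear_sum_left bilinear_simps)
  also have "\<dots> = (\<Sum>x\<in>{v}. u x * b x v)"
    using assms by (intro sum.mono_neutral_right) auto
  finally show ?thesis by simp
qed

lemma independent_pairwise_orthogonal:
  fixes b :: "'e::real_vector \<Rightarrow> 'e \<Rightarrow> real"
  assumes b: "bilinear b" and nz: "\<And>x. x \<in> I \<Longrightarrow> b x x \<noteq> 0"
    and orth: "\<And>x y. x \<in> I \<Longrightarrow> y \<in> I \<Longrightarrow> x \<noteq> y \<Longrightarrow> b x y = 0"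
  shows "independent I"
proof
  assume "dependent I"
  then obtain t u v where t: "finite t" "t \<subseteq> I" "(\<Sum>x\<in>t. u x *\<^sub>R x) = 0" "v \<in> t" "u v \<noteq> 0"
    unfolding dependent_explicit by blast
  have "b (\<Sum>x\<in>t. u x *\<^sub>R x) v = u v * b v v"
    using t orth by (intro bilinear_pairwise_orthogonal_sum b) auto
  then show False
    using t nz b by (auto simp: bilinear_simps)
qed

text \<open>Disjointness and independence come for free: no vector has norm both 1 and -1, and an
  orthogonal family without null vectors is independent. A spanning orthonormal family is thus
  enough.\<close>

lemma has_signatureI:
  fixes b :: "'e::real_vector \<Rightarrow> 'e \<Rightarrow> real"
  assumes "bilinear b" "finite P" "finite Q" "card P = r" "card Q = s" "span (P \<union> Q) = V"
    "\<And>x. x \<in> P \<Longrightarrow> b x x = 1" "\<And>x. x \<in> Q \<Longrightarrow> b x x = -1"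
    "\<And>x y. x \<in> P \<union> Q \<Longrightarrow> y \<in> P \<union> Q \<Longrightarrow> x \<noteq> y \<Longrightarrow> b x y = 0"
  shows "has_signature b V r s"
proof -
  have "P \<inter> Q = {}"
    using assms(7,8) by force
  moreover have "independent (P \<union> Q)"
  proof (rule independent_pairwise_orthogonal[OF assms(1)])
    fix x assume "x \<in> P \<union> Q"
    then show "b x x \<noteq> 0" using assms(7,8) by force
  qed (use assms(9) in auto)
  ultimately show ?thesis
    unfolding has_signature_def using assms(2-6) assms(7-9)
    by (intro exI[of _ P] exI[of _ Q] conjI ballI impI) simp_all
qed

lemma has_signatureE:
  assumes "has_signature b V r s"
  obtains P Q where "finite P" "finite Q" "card P = r" "card Q = s" "span (P \<union> Q) = V"
    "\<forall>x\<in>P. b x x = 1" "\<forall>x\<in>Q. b x x = -1"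
    "\<forall>x\<in>P \<union> Q. \<forall>y\<in>P \<union> Q. x \<noteq> y \<longrightarrow> b x y = 0"
  using assms unfolding has_signature_def by (elim exE conjE) (rule that; assumption)

lemma has_signature_dim:
  fixes b :: "'e::euclidean_space \<Rightarrow> 'e \<Rightarrow> real"
  assumes "has_signature b V r s"
  shows "dim V = r + s"
  using assms unfolding has_signature_def
  by (auto simp: dim_eq_card_independent card_Un_disjoint)

lemma has_signature_nondegenerate:
  assumes b: "bilinear b" and "has_signature b V r s"
  shows "nondegenerate_on b V"
proof -
  obtain P Q where PQ: "finite P" "finite Q" "card P = r" "card Q = s" "span (P \<union> Q) = V"
     "\<forall>x\<in>P. b x x = 1" "\<forall>x\<in>Q. b x x = -1"
     "\<forall>x\<in>P \<union> Q. \<forall>y\<in>P \<union> Q. x \<noteq> y \<longrightarrow> b x y = 0"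
    using assms(2) by (rule has_signatureE)
  show ?thesis
    unfolding nondegenerate_on_def
  proof (intro ballI impI)
    fix x assume x: "x \<in> V" "\<forall>y\<in>V. b x y = 0"
    then obtain u where u: "x = (\<Sum>v\<in>P \<union> Q. u v *\<^sub>R v)"
      using PQ span_finite[of "P \<union> Q"] by auto
    have "u v = 0" if v: "v \<in> P \<union> Q" for v
    proof -
      have "b x v = u v * b v v"
        unfolding u using PQ v by (intro bilinear_pairwise_orthogonal_sum b) auto
      moreover have "v \<in> V"
        using v PQ(5) span_base by blast
      ultimately show ?thesis using x PQ v by auto
    qed
    then show "x = 0" unfolding u by simp
  qed
qed

text \<open>As \<open>e\<close> is orthogonal to \<open>W\<close> but not to itself, it lies outside
  \<open>W\<close>, so the positive part of the basis really grows by one.\<close>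

lemma has_signature_insert_pos:
  assumes b: "bilinear b" and W: "has_signature b W r s" and e: "b e e = 1"
    and orth: "\<And>w. w \<in> W \<Longrightarrow> b e w = 0" "\<And>w. w \<in> W \<Longrightarrow> b w e = 0"
    and V: "V = span (insert e W)"
  shows "has_signature b V (Suc r) s"
proof -
  obtain P Q where PQ: "finite P" "finite Q" "card P = r" "card Q = s" "span (P \<union> Q) = W"
     "\<forall>x\<in>P. b x x = 1" "\<forall>x\<in>Q. b x x = -1"
     "\<forall>x\<in>P \<union> Q. \<forall>y\<in>P \<union> Q. x \<noteq> y \<longrightarrow> b x y = 0"
    using W by (rule has_signatureE)
  have sub: "P \<union> Q \<subseteq> W"
    using PQ(5) span_superset by blast
  have "e \<notin> W"
    using orth e by force
  then have "e \<notin> P"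
    using sub by blast
  moreover have "span (insert e P \<union> Q) = V"
    unfolding V using PQ(5) span_insert[of e W] span_insert[of e "P \<union> Q"]
    by (metis Un_insert_left span_span)
  ultimately show ?thesis
    using PQ sub e orth
    by (intro has_signatureI[where P = "insert e P" and Q = Q] b) (auto simp: subset_iff)
qed

lemma has_signature_uminus:
  assumes "has_signature b V r s"
  shows "has_signature (\<lambda>x y. - b x y) V s r"
  using assms unfolding has_signature_def
  by (elim exE conjE, rename_tac P Q, rule_tac x = Q in exI, rule_tac x = P in exI)
     (simp add: Un_commute Int_commute)

lemma has_signature_insert_neg:
  assumes b: "bilinear b" and W: "has_signature b W r s" and e: "b e e = -1"
    and orth: "\<And>w. w \<in> W \<Longrightarrow> b e w = 0" "\<And>w. w \<in> W \<Longrightarrow> b w e = 0"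
    and V: "V = span (insert e W)"
  shows "has_signature b V r (Suc s)"
proof -
  have "bilinear (\<lambda>x y. - b x y)"
    using b unfolding bilinear_def by (auto intro: linear_compose_neg)
  then have "has_signature (\<lambda>x y. - b x y) V (Suc s) r"
    using assms by (intro has_signature_insert_pos[OF _ has_signature_uminus[OF W]]) auto
  from has_signature_uminus[OF this] show ?thesis by simp
qed

text \<open>Preimages of an orthonormal basis of the range form one of the domain. With
  \<open>T\<close> the differential of the immersion, this carries a signature on the tangent space
  over to the induced metric, which lives on the model space of the submanifold.\<close>

lemma has_signature_pullback:
  fixes T :: "'d::real_vector \<Rightarrow> 'e::real_vector"
  assumes b: "bilinear b" and T: "linear T" "inj T" and sig: "has_signature b (range T) r s"
  shows "has_signature (\<lambda>x y. b (T x) (T y)) UNIV r s"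
proof -
  obtain P Q where PQ: "finite P" "finite Q" "card P = r" "card Q = s" "span (P \<union> Q) = range T"
     "\<forall>x\<in>P. b x x = 1" "\<forall>x\<in>Q. b x x = -1"
     "\<forall>x\<in>P \<union> Q. \<forall>y\<in>P \<union> Q. x \<noteq> y \<longrightarrow> b x y = 0"
    using sig by (rule has_signatureE)
  have sub: "P \<subseteq> range T" "Q \<subseteq> range T"
    using PQ(5) span_superset by blast+
  have "bilinear (\<lambda>x y. b (T x) (T y))"
    using b linear_compose[OF T(1)] unfolding bilinear_def o_def by blast
  moreover have "span (T -` P \<union> T -` Q) = UNIV"
  proof -
    have "T ` span (T -` P \<union> T -` Q) = span (T ` (T -` P \<union> T -` Q))"
      using T(1) by (simp add: linear_span_image)
    also have "T ` (T -` P \<union> T -` Q) = P \<union> Q"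
      using sub by auto
    finally show ?thesis
      using PQ(5) T(2) by (metis inj_image_eq_iff)
  qed
  ultimately show ?thesis
    using PQ T sub
    by (intro has_signatureI[where P = "T -` P" and Q = "T -` Q"])
       (auto simp: finite_vimageI card_vimage_inj inj_eq)
qed

text \<open>
  Peel off a plane spanned by \<open>x\<close> and \<open>J x\<close>: its Gram matrix has trace zero and negative
  determinant, and its orthogonal complement is again \<open>J\<close>-invariant.
\<close>

lemma has_signature_anti_isometric_complex_structure:
  fixes b :: "'e::euclidean_space \<Rightarrow> 'e \<Rightarrow> real"
  assumes b: "bilinear b" and sym: "\<And>x y. b x y = b y x" and J: "linear J"
    and V: "subspace V" "nondegenerate_on b V" "\<And>x. x \<in> V \<Longrightarrow> J x \<in> V"
    and JJ: "\<And>x. x \<in> V \<Longrightarrow> J (J x) = - x"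
    and bJ: "\<And>x y. x \<in> V \<Longrightarrow> y \<in> V \<Longrightarrow> b (J x) (J y) = - b x y"
  shows "has_signature b V (dim V div 2) (dim V div 2)"
proof -
  note bl = bilinear_simps[OF b]
  \<comment> \<open>The induction only tracks that the signature is balanced; its value, and with it
    the evenness of \<open>dim V\<close>, is read off from the dimension afterwards.\<close>
  have "\<exists>m. has_signature b V m m"
    using V JJ bJ
  proof (induction "dim V" arbitrary: V rule: less_induct)
    case less
    note [simp] = subspace_add[OF less.prems(1)] subspace_diff[OF less.prems(1)]
      subspace_scale[OF less.prems(1)] less.prems(3-5)
    show ?case
    proof (cases "V = {0}")
      case True
      then have "has_signature b V 0 0"
        by (intro has_signatureI[where P = "{}" and Q = "{}"] b) auto
      then show ?thesis by blast
    next
      case False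
      \<comment> \<open>Without positive vectors, \<open>b (J x) (J x) = - b x x\<close> would
        exclude negative ones too. Polarisation then makes \<open>b\<close> vanish on
        \<open>V\<close>, against nondegeneracy.\<close>
      have "\<exists>x\<in>V. b x x > 0"
      proof (rule ccontr)
        assume neg: "\<not> ?thesis"
        have null: "b x x = 0" if "x \<in> V" for x
          using neg that less.prems(3)[OF that] less.prems(5)[OF that that]
          by (metis less_irrefl linorder_neqE neg_0_less_iff_less)
        have "b x y = 0" if "x \<in> V" "y \<in> V" for x y
          using null[of "x + y"] null[of x] null[of y] that sym[of x y] by (simp add: bl)
        then show False
          using less.prems(1,2) False subspace_0 unfolding nondegenerate_on_def by blast
      qed
      then obtain x0 where x0: "x0 \<in> V" "b x0 x0 > 0" by blast
      define x where "x = (1 / sqrt (b x0 x0)) *\<^sub>R x0"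
      \<comment> \<open>Gram-Schmidt for \<open>J x\<close> against \<open>x\<close>: the remainder
        has norm \<open>-1 - 2 * c^2 + c^2 = - (1 + c^2)\<close>, negative for every
        \<open>c\<close>.\<close>
      define c where "c = b x (J x)"
      define y where "y = (1 / sqrt (1 + c\<^sup>2)) *\<^sub>R (J x - c *\<^sub>R x)"
      have x: "x \<in> V" "b x x = 1"
        using x0 by (auto simp: x_def bl field_simps)
      have c1: "1 + c\<^sup>2 > 0" by (simp add: add_pos_nonneg)
      have y: "y \<in> V" unfolding y_def using x by simp
      have Jxx: "b (J x) (J x) = -1" using x by simp
      have yy: "b y y = -1"
        using c1 x Jxx sym[of "J x" x]
        by (simp add: y_def bl c_def[symmetric] field_simps power2_eq_square flip: real_sqrt_mult)
      have xy: "b x y = 0" by (simp add: y_def bl c_def[symmetric] x)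
      have Jx: "J x = sqrt (1 + c\<^sup>2) *\<^sub>R y + c *\<^sub>R x"
        using c1 by (simp add: y_def)
      define W where "W = {w \<in> V. b w x = 0 \<and> b w y = 0}"
      have subW: "subspace W"
        using less.prems(1) unfolding W_def subspace_def by (simp add: bl)
      have WJx: "b w (J x) = 0" if "w \<in> W" for w
        using that unfolding Jx W_def by (simp add: bl)
      \<comment> \<open>The sign at \<open>y\<close> is reversed because
        \<open>b y y = -1\<close>.\<close>
      have split: "v = b v x *\<^sub>R x - b v y *\<^sub>R y + (v - b v x *\<^sub>R x + b v y *\<^sub>R y)"
        "v - b v x *\<^sub>R x + b v y *\<^sub>R y \<in> W" if "v \<in> V" for v
        using that x y yy xy sym[of y x] unfolding W_def by (auto simp: bl)
      have "W \<subseteq> V" "x \<in> V - W"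
        using x by (auto simp: W_def)
      then have "dim W < dim V"
        by (metis Diff_iff dim_psubset psubsetI subW less.prems(1) span_eq_iff)
      moreover have "nondegenerate_on b W"
        unfolding nondegenerate_on_def
      proof (intro ballI impI)
        fix w assume w: "w \<in> W" "\<forall>z\<in>W. b w z = 0"
        have "b w v = 0" if "v \<in> V" for v
        proof -
          have "b w (v - b v x *\<^sub>R x + b v y *\<^sub>R y) = 0"
            using w split(2)[OF that] by blast
          then show ?thesis
            using w(1) by (simp add: bl W_def)
        qed
        then show "w = 0"
          using w less.prems(2) unfolding nondegenerate_on_def W_def by auto
      qed
      \<comment> \<open>\<open>J x\<close> lies in the plane of \<open>x\<close> and
        \<open>y\<close>, so \<open>w\<close> is orthogonal to it. Since
        \<open>J (J x) = - x\<close>, the anti-isometry turns this into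
        \<open>b (J w) x = b w (J x) = 0\<close>.\<close>
      moreover have "J w \<in> W" if w: "w \<in> W" for w
      proof -
        have wV: "w \<in> V" using w W_def by auto
        have "b (J w) (J (J x)) = - b w (J x)"
          by (rule less.prems(5)) (use wV x in simp_all)
        then have 1: "b (J w) x = 0"
          using WJx[OF w] x by (simp add: bl)
        have "b (J w) (J x) = 0"
          using w wV x by (auto simp: W_def)
        then have "b (J w) y = 0" using 1 by (simp add: y_def bl)
        with 1 show ?thesis using wV by (simp add: W_def)
      qed
      ultimately obtain m where m: "has_signature b W m m"
        using less.hyps[of W] subW by (auto simp: W_def)
      have "has_signature b (span (insert y W)) m (Suc m)"
        using yy sym by (intro has_signature_insert_neg[OF b m]) (auto simp: W_def)
      moreover have "b w x = 0" if "w \<in> span (insert y W)" for w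
        using that
      proof (induction rule: span_induct_alt)
        case (step a z w)
        then show ?case using xy sym[of y x] by (auto simp: bl W_def)
      qed (simp add: bl)
      ultimately have "has_signature b (span (insert x (span (insert y W)))) (Suc m) (Suc m)"
        using x sym by (intro has_signature_insert_pos[OF b]) auto
      moreover have "span (insert x (span (insert y W))) = V"
      proof
        show "span (insert x (span (insert y W))) \<subseteq> V"
          using x y less.prems(1) by (intro span_minimal insert_subsetI) (auto simp: W_def)
        show "V \<subseteq> span (insert x (span (insert y W)))"
        proof
          fix v assume v: "v \<in> V"
          obtain w where w: "w \<in> W" "v = b v x *\<^sub>R x - b v y *\<^sub>R y + w"
            using split[OF v] by blast
          have "- b v y *\<^sub>R y + w \<in> span (insert y W)"
            using w(1) by (intro span_add span_scale span_base) auto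
          then have "b v x *\<^sub>R x + (- b v y *\<^sub>R y + w) \<in> span (insert x (span (insert y W)))"
            by (intro span_add span_scale span_base) auto
          then show "v \<in> span (insert x (span (insert y W)))"
            by (subst w(2)) (simp add: algebra_simps)
        qed
      qed
      ultimately show ?thesis by auto
    qed
  qed
  then obtain m where "has_signature b V m m" by blast
  with has_signature_dim[OF this] show ?thesis by simp
qed

section \<open>Vector spaces with an almost contact B-metric\<close>

lemma subspace_dim_1_scale:
  fixes V :: "'e::euclidean_space set"
  assumes "subspace V" "dim V = 1" "x \<in> V" "x \<noteq> 0" "y \<in> V"
  obtains k where "y = k *\<^sub>R x"
proof -
  have "span {x} = span V"
    using assms by (intro dim_eq_span) auto
  then have "span {x} = V"
    using assms(1) by (simp add: span_eq_iff)
  then show ?thesis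
    using assms(5) that by (auto simp: span_singleton)
qed

locale B_metric_vector_space =
  fixes \<phi> :: "'e::euclidean_space \<Rightarrow> 'e" and \<zeta> :: 'e and \<eta> :: "'e \<Rightarrow> real"
    and g :: "'e \<Rightarrow> 'e \<Rightarrow> real"
  assumes linear_\<phi>: "linear \<phi>" and linear_\<eta>: "linear \<eta>" and bilinear_g: "bilinear g"
    and g_sym: "g X Y = g Y X" and nondeg: "nondegenerate_on g UNIV"
    and \<phi>\<phi>: "\<phi> (\<phi> X) = - X + \<eta> X *\<^sub>R \<zeta>" and \<eta>\<zeta>: "\<eta> \<zeta> = 1"
    and g\<phi>\<phi>: "g (\<phi> X) (\<phi> Y) = - g X Y + \<eta> X * \<eta> Y"
begin

definition gt :: "'e \<Rightarrow> 'e \<Rightarrow> real" where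
  "gt X Y = g X (\<phi> Y) + \<eta> X * \<eta> Y"

lemmas g_simps = bilinear_simps[OF bilinear_g]
lemmas \<phi>_simps = linear_add[OF linear_\<phi>] linear_diff[OF linear_\<phi>] linear_neg[OF linear_\<phi>]
  linear_0[OF linear_\<phi>] linear_cmul[OF linear_\<phi>]
lemmas \<eta>_simps = linear_add[OF linear_\<eta>] linear_diff[OF linear_\<eta>] linear_neg[OF linear_\<eta>]
  linear_0[OF linear_\<eta>] linear_cmul[OF linear_\<eta>]

lemma \<zeta>_nonzero: "\<zeta> \<noteq> 0"
  using \<eta>\<zeta> by (auto simp: \<eta>_simps)

text \<open>The formula for the square of \<open>\<phi>\<close> kills \<open>\<zeta>\<close>;
  evaluated at \<open>\<phi> \<zeta>\<close> it then shows that \<open>\<phi> \<zeta>\<close> is a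
  multiple \<open>k\<close> of \<open>\<zeta>\<close>. Applying \<open>\<phi>\<close> once more
  makes \<open>k\<close> times \<open>\<phi> \<zeta>\<close> vanish, and either factor being zero
  suffices.\<close>

lemma \<phi>\<zeta>: "\<phi> \<zeta> = 0"
proof -
  have 0: "\<phi> (\<phi> \<zeta>) = 0"
    by (simp add: \<phi>\<phi> \<eta>\<zeta>)
  then have 1: "\<phi> \<zeta> = \<eta> (\<phi> \<zeta>) *\<^sub>R \<zeta>"
    using \<phi>\<phi>[of "\<phi> \<zeta>"] by (simp add: \<phi>_simps)
  then have "\<eta> (\<phi> \<zeta>) *\<^sub>R \<phi> \<zeta> = 0"
    using 0 by (metis \<phi>_simps(5))
  then show ?thesis
    using 1 by auto
qed

text \<open>The cube of \<open>\<phi>\<close> is computed in two ways, with the square formula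
  inside or outside; the results differ by \<open>\<eta> (\<phi> X)\<close> times the nonzero
  \<open>\<zeta>\<close>.\<close>

lemma \<eta>\<phi>: "\<eta> (\<phi> X) = 0"
proof -
  have "\<phi> (\<phi> (\<phi> X)) = - \<phi> X"
    by (subst \<phi>\<phi>) (simp add: \<phi>_simps \<phi>\<zeta>)
  then show ?thesis
    using \<phi>\<phi>[of "\<phi> X"] \<zeta>_nonzero by simp
qed

lemma g\<zeta>: "g X \<zeta> = \<eta> X" "g \<zeta> X = \<eta> X"
  using g\<phi>\<phi>[of X \<zeta>] g_sym[of X \<zeta>] by (simp_all add: \<phi>\<zeta> \<eta>\<zeta> g_simps)

text \<open>Self-adjointness of \<open>\<phi>\<close> is what makes \<open>gt\<close> symmetric, and
  it later moves \<open>\<phi>\<close> from screen vectors onto the frame.\<close>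

lemma g_\<phi>_commute: "g (\<phi> X) Y = g X (\<phi> Y)"
  using g\<phi>\<phi>[of X "\<phi> Y"] by (simp add: \<phi>\<phi> \<eta>\<phi> g_simps g\<zeta>)

lemma bilinear_gt: "bilinear gt"
  unfolding bilinear_def gt_def
  by (auto intro!: linearI simp: g_simps \<phi>_simps \<eta>_simps algebra_simps)

lemmas gt_simps = bilinear_simps[OF bilinear_gt]

lemma gt_sym: "gt X Y = gt Y X"
  using g_\<phi>_commute[of X Y] g_sym[of "\<phi> X" Y] by (simp add: gt_def)

lemma gt_\<zeta>: "gt X \<zeta> = \<eta> X" "gt \<zeta> X = \<eta> X"
  by (simp_all add: gt_def \<phi>\<zeta> \<eta>\<zeta> g\<zeta> \<eta>\<phi> g_simps)

text \<open>On the kernel of \<open>\<eta>\<close> the inverse of \<open>\<phi>\<close> is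
  \<open>- \<phi>\<close>, so \<open>gt x (- \<phi> y) = g x y\<close> and nondegeneracy passes from
  \<open>g\<close> to \<open>gt\<close>. The compatibility of \<open>g\<close> with
  \<open>\<phi>\<close> supplies the change of sign.\<close>

lemma has_signature_gt_invariant:
  assumes V: "subspace V" "\<And>x. x \<in> V \<Longrightarrow> \<phi> x \<in> V" "\<And>x. x \<in> V \<Longrightarrow> \<eta> x = 0"
    and nd: "nondegenerate_on g V"
  shows "has_signature gt V (dim V div 2) (dim V div 2)"
proof (rule has_signature_anti_isometric_complex_structure[OF bilinear_gt gt_sym linear_\<phi> V(1)])
  show "nondegenerate_on gt V"
    unfolding nondegenerate_on_def
  proof (intro ballI impI)
    fix x assume x: "x \<in> V" "\<forall>y\<in>V. gt x y = 0"
    have "g x y = 0" if y: "y \<in> V" for y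
    proof -
      have "gt x (- \<phi> y) = g x y"
        using x(1) y V(3) by (simp add: gt_def \<phi>_simps \<phi>\<phi> \<eta>_simps \<eta>\<phi>)
      moreover have "- \<phi> y \<in> V"
        using V(1,2) y by (simp add: subspace_neg)
      ultimately show ?thesis using x(2) by metis
    qed
    then show "x = 0"
      using nd x(1) unfolding nondegenerate_on_def by blast
  qed
  show "\<phi> (\<phi> x) = - x" if "x \<in> V" for x
    using V(3)[OF that] by (simp add: \<phi>\<phi>)
  show "gt (\<phi> x) (\<phi> y) = - gt x y" if "x \<in> V" "y \<in> V" for x y
    using V(3) that by (simp add: gt_def g\<phi>\<phi> \<eta>\<phi>)
qed (rule V(2))

lemma has_signature_gt_UNIV:
  assumes "DIM('e) = 2 * n + 1"
  shows "has_signature gt UNIV (Suc n) n"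
proof -
  define D where "D = {x. \<eta> x = 0}"
  have D: "subspace D"
    unfolding D_def subspace_def by (simp add: \<eta>_simps)
  have split: "x = \<eta> x *\<^sub>R \<zeta> + (x - \<eta> x *\<^sub>R \<zeta>)" "x - \<eta> x *\<^sub>R \<zeta> \<in> D" for x
    by (auto simp: D_def \<eta>_simps \<eta>\<zeta>)
  have UNIV: "UNIV = span (insert \<zeta> D)"
  proof (rule subset_antisym[OF subsetI subset_UNIV])
    fix x :: 'e
    show "x \<in> span (insert \<zeta> D)"
      by (subst split(1)[of x]) (intro span_add span_scale span_base insertI1 insertI2 split(2))
  qed
  have "nondegenerate_on g D"
    unfolding nondegenerate_on_def
  proof (intro ballI impI)
    fix x assume x: "x \<in> D" "\<forall>y\<in>D. g x y = 0"
    have "g x y = 0" for y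
      using x split(2)[of y] by (subst split(1)[of y]) (auto simp: g_simps g\<zeta> D_def)
    then show "x = 0"
      using nondeg unfolding nondegenerate_on_def by blast
  qed
  then have sig: "has_signature gt D (dim D div 2) (dim D div 2)"
    using D by (intro has_signature_gt_invariant) (auto simp: D_def \<eta>\<phi>)
  then have "has_signature gt UNIV (Suc (dim D div 2)) (dim D div 2)"
    by (intro has_signature_insert_pos[OF bilinear_gt sig _ _ _ UNIV]) (auto simp: gt_\<zeta> \<eta>\<zeta> D_def)
  \<comment> \<open>The entries of the signature just found add up to
    \<open>2 * (dim D div 2) + 1\<close>, which must be \<open>2 * n + 1\<close>; this avoids
    computing \<open>dim D\<close>.\<close>
  moreover from has_signature_dim[OF this] assms have "dim D div 2 = n"
    by simp
  ultimately show ?thesis by simp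
qed

end

section \<open>Linear algebra at one point of an ascreen radical screen transversal half lightlike
  submanifold\<close>

locale ascreen_rst_vector_space = B_metric_vector_space \<phi> \<zeta> \<eta> g
  for \<phi> :: "'e::euclidean_space \<Rightarrow> 'e" and \<zeta> \<eta> g +
  fixes T R S ST :: "'e set"
  assumes T: "subspace T" and R: "R = T \<inter> {v. \<forall>w\<in>T. g v w = 0}" and dim_R: "dim R = 1"
    and S: "subspace S" "dim S + 3 = DIM('e)" "nondegenerate_on g S"
    and ST: "subspace ST" "dim ST = 1"
    and T_sum: "orthogonal_direct_sum g R S T"
    and normal_sum: "orthogonal_direct_sum g R ST {v. \<forall>w\<in>T. g v w = 0}"
    and rst: "\<phi> ` R = ST"
    and ascreen: "\<exists>u\<in>R. \<exists>v\<in>span {N. \<exists>\<xi>\<in>R. \<exists>L\<in>ST. \<xi> \<noteq> 0 \<and> \<bar>g L L\<bar> = 1 \<and>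
                     null_transversal g S \<xi> L N}. \<zeta> = u + v"
begin

text \<open>Matches the membership condition of the set whose span is the lightlike transversal
  line, so that every generator of that line brings a frame with it.\<close>

definition frame :: "'e \<Rightarrow> 'e \<Rightarrow> 'e \<Rightarrow> bool" where
  "frame \<xi> N L \<longleftrightarrow> \<xi> \<in> R \<and> L \<in> ST \<and> \<xi> \<noteq> 0 \<and> \<bar>g L L\<bar> = 1 \<and> null_transversal g S \<xi> L N"

text \<open>These are the conditions that the local fields of the theorem satisfy at each point,
  including the choice of sign of \<open>L\<close>.\<close>

definition adapted_frame :: "'e \<Rightarrow> 'e \<Rightarrow> 'e \<Rightarrow> real \<Rightarrow> bool" where
  "adapted_frame \<xi> N L \<mu> \<longleftrightarrow> frame \<xi> N L \<and> \<phi> \<xi> = \<mu> *\<^sub>R L \<and> \<mu> \<noteq> 0 \<and> \<eta> \<xi> = \<mu>"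

lemma subspace_R: "subspace R"
  using T unfolding R subspace_def by (simp add: g_simps)

lemma S_subset_T: "S \<subseteq> T"
  using T_sum subspace_0[OF subspace_R] unfolding orthogonal_direct_sum_def by fastforce

lemma ST_subset_normal: "x \<in> ST \<Longrightarrow> w \<in> T \<Longrightarrow> g x w = 0"
proof -
  assume *: "x \<in> ST" "w \<in> T"
  have "x = 0 + x" by simp
  then have "x \<in> {v. \<forall>w\<in>T. g v w = 0}"
    using normal_sum subspace_0[OF subspace_R] *(1) unfolding orthogonal_direct_sum_def by blast
  with * show ?thesis by blast
qed

lemma frame_orthogonality:
  assumes "frame \<xi> N L"
  shows "g \<xi> \<xi> = 0" "g \<xi> L = 0" "g L \<xi> = 0" "g N \<xi> = 1" "g \<xi> N = 1" "g N N = 0" "g N L = 0" "g L N = 0"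
    and "s \<in> S \<Longrightarrow> g s \<xi> = 0" "s \<in> S \<Longrightarrow> g \<xi> s = 0" "s \<in> S \<Longrightarrow> g s L = 0" "s \<in> S \<Longrightarrow> g L s = 0"
      "s \<in> S \<Longrightarrow> g s N = 0" "s \<in> S \<Longrightarrow> g N s = 0"
proof -
  have "\<xi> \<in> R"
    using assms unfolding frame_def by blast
  then have \<xi>: "\<xi> \<in> T" "\<And>w. w \<in> T \<Longrightarrow> g \<xi> w = 0"
    unfolding R by auto
  have L: "\<And>w. w \<in> T \<Longrightarrow> g L w = 0"
    using assms ST_subset_normal unfolding frame_def by auto
  have N: "g N \<xi> = 1" "g N N = 0" "g N L = 0" "\<And>s. s \<in> S \<Longrightarrow> g N s = 0"
    using assms unfolding frame_def null_transversal_def by auto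
  show 1: "g \<xi> \<xi> = 0" "g L \<xi> = 0" "g N \<xi> = 1" "g N N = 0" "g N L = 0"
    using \<xi> L N by auto
  then show "g \<xi> L = 0" "g \<xi> N = 1" "g L N = 0"
    by (simp_all add: g_sym[of \<xi> L] g_sym[of \<xi> N] g_sym[of L N])
  assume "s \<in> S"
  then show 2: "g \<xi> s = 0" "g L s = 0" "g N s = 0"
    using \<xi> L N S_subset_T by auto
  then show "g s \<xi> = 0" "g s L = 0" "g s N = 0"
    by (simp_all add: g_sym[of s \<xi>] g_sym[of s L] g_sym[of s N])
qed

text \<open>Pairing a combination of \<open>\<xi>\<close>, \<open>N\<close>, \<open>L\<close> that
  lies in \<open>S\<close> with \<open>N\<close>, \<open>\<xi>\<close> and \<open>L\<close> isolates
  its three coefficients, so the span of the frame has dimension 3 and meets \<open>S\<close> only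
  in 0. As \<open>dim S + 3\<close> is the full dimension, the two spaces fill everything.\<close>

lemma frame_decomposition:
  assumes F: "frame \<xi> N L"
  obtains a b c s where "s \<in> S" "x = a *\<^sub>R \<xi> + b *\<^sub>R N + c *\<^sub>R L + s"
proof -
  note o = frame_orthogonality[OF F]
  have LL: "g L L \<noteq> 0" using F unfolding frame_def by auto
  have coords: "a = 0 \<and> b = 0 \<and> c = 0" if "a *\<^sub>R \<xi> + b *\<^sub>R N + c *\<^sub>R L \<in> S" for a b c
    using o(9,11,13)[OF that] LL by (simp add: g_simps o)
  define V where "V = span {\<xi>, N, L}"
  let ?Z = "{x + y |x y. x \<in> V \<and> y \<in> S}"
  have V: "\<exists>a b c. v = a *\<^sub>R \<xi> + b *\<^sub>R N + c *\<^sub>R L" if "v \<in> V" for v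
    using that unfolding V_def span_insert span_empty
    by (auto simp: algebra_simps)
  have "V \<inter> S = {0}"
  proof -
    have "v = 0" if v: "v \<in> V" "v \<in> S" for v
    proof -
      obtain a b c where abc: "v = a *\<^sub>R \<xi> + b *\<^sub>R N + c *\<^sub>R L"
        using V[OF v(1)] by blast
      with coords[of a b c] v(2) have "a = 0 \<and> b = 0 \<and> c = 0" by metis
      with abc show ?thesis by simp
    qed
    moreover have "0 \<in> V \<inter> S"
      using S(1) by (simp add: V_def subspace_0 span_zero)
    ultimately show ?thesis by blast
  qed
  moreover have "dim V = 3"
  proof -
    have 0: "0 \<in> S" using S(1) by (simp add: subspace_0)
    have ne: "N \<noteq> L" "\<xi> \<noteq> N" "\<xi> \<noteq> L"
      using o LL by auto
    have "independent {\<xi>, N, L}"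
    proof
      assume "dependent {\<xi>, N, L}"
      then obtain u v where u: "(\<Sum>v\<in>{\<xi>, N, L}. u v *\<^sub>R v) = 0" "v \<in> {\<xi>, N, L}" "u v \<noteq> 0"
        by (subst (asm) dependent_finite) auto
      have "u \<xi> *\<^sub>R \<xi> + u N *\<^sub>R N + u L *\<^sub>R L = 0"
        using u(1) ne by (simp add: algebra_simps)
      with coords[of "u \<xi>" "u N" "u L"] u 0 show False by auto
    qed
    then show ?thesis
      unfolding V_def using ne by (simp add: dim_eq_card_independent)
  qed
  ultimately have dim: "dim ?Z = DIM('e)"
    using dim_sums_Int[of V S] S by (simp add: V_def)
  have "subspace ?Z"
    using S(1) by (intro subspace_sums) (auto simp: V_def)
  then have "?Z = span ?Z"
    by (rule sym[OF iffD2[OF span_eq_iff]])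
  also have "\<dots> = UNIV"
    using dim by (simp only: dim_eq_full)
  finally have "x \<in> ?Z"
    by (simp only: UNIV_I)
  then obtain v s where vs: "x = v + s" "v \<in> V" "s \<in> S"
    by blast
  obtain a b c where "v = a *\<^sub>R \<xi> + b *\<^sub>R N + c *\<^sub>R L"
    using V[OF vs(2)] by blast
  with vs show ?thesis by (intro that[of s a b c]) simp_all
qed

lemma frame_in_S:
  assumes F: "frame \<xi> N L" and "g x \<xi> = 0" "g x N = 0" "g x L = 0"
  shows "x \<in> S"
proof -
  note o = frame_orthogonality[OF F]
  obtain a b c s where s: "s \<in> S" "x = a *\<^sub>R \<xi> + b *\<^sub>R N + c *\<^sub>R L + s"
    using frame_decomposition[OF F] .
  have "g L L \<noteq> 0" using F unfolding frame_def by auto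
  then show ?thesis
    using assms(2-4) s by (auto simp: g_simps o)
qed

text \<open>Radical and screen transversal space are lines, so both frames have proportional
  \<open>\<xi>\<close> and \<open>L\<close>. Expand \<open>N'\<close> in the first frame:
  orthogonality to \<open>L\<close> and to the nondegenerate \<open>S\<close> removes those
  components, pairing with \<open>\<xi>\<close> gives a nonzero coefficient of \<open>N\<close>, and
  \<open>g N' N' = 0\<close>, twice the product of the remaining coefficients, removes
  \<open>\<xi>\<close>.\<close>

lemma frame_transversal_unique:
  assumes F: "frame \<xi> N L" and F': "frame \<xi>' N' L'"
  obtains k where "N' = k *\<^sub>R N"
proof -
  note o = frame_orthogonality[OF F]
  note o' = frame_orthogonality[OF F']
  obtain k where k: "\<xi> = k *\<^sub>R \<xi>'"
    using subspace_dim_1_scale[OF subspace_R dim_R] F F' unfolding frame_def by metis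
  have "L' \<noteq> 0" using F' by (auto simp: frame_def g_simps)
  then obtain l where l: "L = l *\<^sub>R L'"
    using subspace_dim_1_scale[OF ST] F F' unfolding frame_def by metis
  obtain a b c s where s: "s \<in> S" "N' = a *\<^sub>R \<xi> + b *\<^sub>R N + c *\<^sub>R L + s"
    using frame_decomposition[OF F] .
  have "g L L \<noteq> 0" using F unfolding frame_def by auto
  moreover have "g N' L = 0" by (simp add: l g_simps o')
  ultimately have "c = 0"
    using s by (simp add: g_simps o)
  have "g s t = 0" if t: "t \<in> S" for t
  proof -
    have "g N' t = 0" using o'(14)[OF t] .
    then show ?thesis by (simp add: s g_simps o t)
  qed
  then have "s = 0"
    using S(3) s(1) unfolding nondegenerate_on_def by blast
  have "k \<noteq> 0" using k F unfolding frame_def by auto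
  have "g N' \<xi> = k" by (simp add: k g_simps o')
  then have b: "b = k"
    using s(2) \<open>s = 0\<close> \<open>c = 0\<close> by (simp add: g_simps o)
  have "g N' N' = 0" by (rule o')
  then have "a = 0"
    using s(2) \<open>s = 0\<close> \<open>c = 0\<close> b \<open>k \<noteq> 0\<close> by (simp add: g_simps o)
  then show ?thesis
    using that[of b] s(2) \<open>s = 0\<close> \<open>c = 0\<close> by simp
qed

text \<open>The transversal space in \<open>ascreen\<close> is spanned by the vectors of all frames;
  uniqueness up to scale collapses it to the line of the given \<open>N\<close>.\<close>

lemma frame_\<zeta>:
  assumes F: "frame \<xi> N L"
  obtains a b where "\<zeta> = a *\<^sub>R \<xi> + b *\<^sub>R N"
proof -
  have "{N. \<exists>\<xi>\<in>R. \<exists>L\<in>ST. \<xi> \<noteq> 0 \<and> \<bar>g L L\<bar> = 1 \<and> null_transversal g S \<xi> L N} \<subseteq> span {N}"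
  proof
    fix N' assume "N' \<in> {N. \<exists>\<xi>\<in>R. \<exists>L\<in>ST. \<xi> \<noteq> 0 \<and> \<bar>g L L\<bar> = 1 \<and> null_transversal g S \<xi> L N}"
    then obtain \<xi>' L' where "frame \<xi>' N' L'"
      unfolding frame_def by blast
    then obtain k where "N' = k *\<^sub>R N"
      using frame_transversal_unique[OF F] by blast
    then show "N' \<in> span {N}"
      by (simp add: span_base span_scale)
  qed
  from span_mono[OF this] have "span {N. \<exists>\<xi>\<in>R. \<exists>L\<in>ST. \<xi> \<noteq> 0 \<and> \<bar>g L L\<bar> = 1 \<and> null_transversal g S \<xi> L N}
      \<subseteq> span {N}"
    unfolding span_span .
  with ascreen obtain u v where "u \<in> R" "v \<in> span {N}" "\<zeta> = u + v"
    by blast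
  then obtain b where "\<zeta> = u + b *\<^sub>R N"
    by (auto simp: span_singleton)
  moreover obtain a where "u = a *\<^sub>R \<xi>"
    using subspace_dim_1_scale[OF subspace_R dim_R] F \<open>u \<in> R\<close> unfolding frame_def by metis
  ultimately show ?thesis using that by blast
qed

text \<open>If there were no frame, the transversal span would be zero and \<open>\<zeta>\<close>
  would lie in the radical. Radical vectors are null, whereas \<open>\<zeta>\<close> has norm
  1.\<close>

lemma frame_exists: "\<exists>\<xi> N L. frame \<xi> N L"
proof (rule ccontr)
  assume "\<not> ?thesis"
  then have "{N. \<exists>\<xi>\<in>R. \<exists>L\<in>ST. \<xi> \<noteq> 0 \<and> \<bar>g L L\<bar> = 1 \<and> null_transversal g S \<xi> L N} = {}"
    unfolding frame_def by blast
  then have "\<zeta> \<in> R" using ascreen by (simp only: span_empty) simp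
  then have "g \<zeta> \<zeta> = 0" unfolding R by blast
  then show False by (simp add: g\<zeta> \<eta>\<zeta>)
qed

text \<open>\<open>\<mu>\<close> cannot vanish because \<open>\<phi>\<close> maps the radical onto a
  nonzero line. Compatibility at \<open>\<xi>\<close> reads
  \<open>(\<eta> \<xi>)^2 = \<mu>^2 * g L L\<close>, which excludes \<open>g L L = -1\<close> and
  leaves \<open>\<eta> \<xi>\<close> equal to \<open>\<mu>\<close> or \<open>- \<mu>\<close>; in the
  second case \<open>L\<close> and \<open>\<mu>\<close> both change sign, preserving
  \<open>\<phi> \<xi>\<close>.\<close>

lemma adapted_frame_exists: "\<exists>\<xi> N L \<mu>. adapted_frame \<xi> N L \<mu>"
proof -
  obtain \<xi> N L where F: "frame \<xi> N L" using frame_exists by blast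
  note o = frame_orthogonality[OF F]
  have L: "L \<in> ST" "L \<noteq> 0" and \<xi>: "\<xi> \<in> R" "\<xi> \<noteq> 0" and LL: "\<bar>g L L\<bar> = 1"
    using F by (auto simp: frame_def g_simps)
  obtain \<mu> where \<mu>: "\<phi> \<xi> = \<mu> *\<^sub>R L"
    using subspace_dim_1_scale[OF ST L, of "\<phi> \<xi>"] \<xi> rst by blast
  have "\<mu> \<noteq> 0"
  proof
    assume "\<mu> = 0"
    have "\<phi> (k *\<^sub>R \<xi>) = 0" for k
      using \<mu> \<open>\<mu> = 0\<close> by (simp add: \<phi>_simps)
    then have "\<phi> ` R \<subseteq> {0}"
      using subspace_dim_1_scale[OF subspace_R dim_R \<xi>] by (metis image_subsetI insertI1)
    then show False using rst L by blast
  qed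
  have "(\<eta> \<xi>)\<^sup>2 = \<mu>\<^sup>2 * g L L"
    using g\<phi>\<phi>[of \<xi> \<xi>] \<mu> by (simp add: g_simps o power2_eq_square)
  then have "\<mu>\<^sup>2 * g L L \<ge> 0" by (metis zero_le_power2)
  then have "g L L = 1"
    using LL \<open>\<mu> \<noteq> 0\<close> by (auto simp: zero_le_mult_iff abs_if split: if_splits)
  then have "\<eta> \<xi> = \<mu> \<or> \<eta> \<xi> = - \<mu>"
    using \<open>(\<eta> \<xi>)\<^sup>2 = \<mu>\<^sup>2 * g L L\<close> by (simp add: power2_eq_iff)
  then show ?thesis
  proof
    assume "\<eta> \<xi> = \<mu>"
    then show ?thesis using F \<mu> \<open>\<mu> \<noteq> 0\<close> unfolding adapted_frame_def by blast
  next
    assume "\<eta> \<xi> = - \<mu>"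
    moreover have "frame \<xi> N (- L)"
      using F ST(1) unfolding frame_def null_transversal_def by (simp add: g_simps subspace_neg)
    ultimately have "adapted_frame \<xi> N (- L) (- \<mu>)"
      unfolding adapted_frame_def using \<mu> \<open>\<mu> \<noteq> 0\<close> by simp
    then show ?thesis by blast
  qed
qed

text \<open>For \<open>\<zeta> = a *\<^sub>R \<xi> + b *\<^sub>R N\<close>, pairing with
  \<open>\<xi>\<close> and \<open>N\<close> gives \<open>b = \<mu>\<close> and
  \<open>\<eta> N = a\<close>, so \<open>\<eta> \<zeta> = 1\<close> becomes
  \<open>2 * a * \<mu> = 1\<close>. Then \<open>\<phi> L\<close> follows from the square of
  \<open>\<phi>\<close> at \<open>\<xi>\<close>, and \<open>\<phi> N\<close> from
  \<open>\<phi> \<zeta> = 0\<close>.\<close>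

lemma adapted_frame_relations:
  assumes F: "adapted_frame \<xi> N L \<mu>"
  shows "g L L = 1" "\<eta> L = 0"
    "\<zeta> = (1 / (2 * \<mu>)) *\<^sub>R \<xi> + \<mu> *\<^sub>R N"
    "\<phi> L = \<zeta> - (1 / \<mu>) *\<^sub>R \<xi>"
    "\<phi> N = - (1 / (2 * \<mu>\<^sup>2)) *\<^sub>R \<phi> \<xi>"
proof -
  have F': "frame \<xi> N L" and \<mu>: "\<phi> \<xi> = \<mu> *\<^sub>R L" "\<mu> \<noteq> 0" "\<eta> \<xi> = \<mu>"
    using F unfolding adapted_frame_def by auto
  note o = frame_orthogonality[OF F']
  show "g L L = 1"
    using g\<phi>\<phi>[of \<xi> \<xi>] \<mu> by (simp add: g_simps o power2_eq_square)
  obtain a b where \<zeta>: "\<zeta> = a *\<^sub>R \<xi> + b *\<^sub>R N"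
    using frame_\<zeta>[OF F'] .
  have "g \<xi> \<zeta> = b" by (simp add: \<zeta> g_simps o)
  then have b: "b = \<mu>" by (simp add: g\<zeta> \<mu>)
  have N: "\<eta> N = a" unfolding g\<zeta>(1)[symmetric] by (simp add: \<zeta> g_simps o)
  have "\<eta> \<zeta> = a * \<mu> + \<mu> * a"
    by (subst \<zeta>) (simp add: \<eta>_simps N \<mu> b)
  then have a: "a = 1 / (2 * \<mu>)"
    using \<mu>(2) by (simp add: \<eta>\<zeta> field_simps)
  show "\<zeta> = (1 / (2 * \<mu>)) *\<^sub>R \<xi> + \<mu> *\<^sub>R N"
    using \<zeta> by (simp add: a b)
  show "\<eta> L = 0"
    unfolding g\<zeta>(1)[symmetric] by (simp add: \<zeta> g_simps o)
  have "\<mu> *\<^sub>R \<phi> L = - \<xi> + \<mu> *\<^sub>R \<zeta>"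
    using \<phi>\<phi>[of \<xi>] by (simp add: \<mu> \<phi>_simps)
  then have "(1 / \<mu>) *\<^sub>R (\<mu> *\<^sub>R \<phi> L) = (1 / \<mu>) *\<^sub>R (- \<xi> + \<mu> *\<^sub>R \<zeta>)" by simp
  then show "\<phi> L = \<zeta> - (1 / \<mu>) *\<^sub>R \<xi>"
    using \<mu>(2) by (simp add: algebra_simps)
  have "a *\<^sub>R \<phi> \<xi> + \<mu> *\<^sub>R \<phi> N = 0"
    using \<phi>\<zeta> by (subst (asm) \<zeta>) (simp add: \<phi>_simps b)
  then have "\<mu> *\<^sub>R \<phi> N = - (a *\<^sub>R \<phi> \<xi>)"
    by (simp add: eq_neg_iff_add_eq_0 add.commute)
  then have "(1 / \<mu>) *\<^sub>R (\<mu> *\<^sub>R \<phi> N) = (1 / \<mu>) *\<^sub>R - (a *\<^sub>R \<phi> \<xi>)"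
    by simp
  then show "\<phi> N = - (1 / (2 * \<mu>\<^sup>2)) *\<^sub>R \<phi> \<xi>"
    using \<mu>(2) by (simp add: a power2_eq_square algebra_simps)
qed

text \<open>\<open>\<zeta>\<close> is a combination of \<open>\<xi>\<close> and \<open>N\<close>,
  hence orthogonal to \<open>S\<close>. Moved across by self-adjointness, \<open>\<phi>\<close>
  sends the frame into the span of \<open>\<xi>\<close>, \<open>L\<close> and
  \<open>\<zeta>\<close>, all orthogonal to \<open>x\<close>; so \<open>\<phi> x\<close> is
  orthogonal to the frame and lies in \<open>S\<close>.\<close>

lemma S_invariant: "x \<in> S \<Longrightarrow> \<phi> x \<in> S" and \<eta>_S: "x \<in> S \<Longrightarrow> \<eta> x = 0"
proof -
  assume x: "x \<in> S"
  obtain \<xi> N L \<mu> where F: "adapted_frame \<xi> N L \<mu>" using adapted_frame_exists by blast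
  then have F': "frame \<xi> N L" and \<mu>: "\<phi> \<xi> = \<mu> *\<^sub>R L" "\<mu> \<noteq> 0" "\<eta> \<xi> = \<mu>"
    unfolding adapted_frame_def by auto
  note o = frame_orthogonality[OF F'] and r = adapted_frame_relations[OF F]
  show \<eta>x: "\<eta> x = 0"
    unfolding g\<zeta>(1)[symmetric] r(3) by (simp add: g_simps o x)
  show "\<phi> x \<in> S"
  proof (rule frame_in_S[OF F'])
    show "g (\<phi> x) \<xi> = 0"
      unfolding g_\<phi>_commute \<mu>(1) by (simp add: g_simps o x)
    show "g (\<phi> x) N = 0"
      unfolding g_\<phi>_commute r(5) \<mu>(1) by (simp add: g_simps o x)
    show "g (\<phi> x) L = 0"
      unfolding g_\<phi>_commute r(4) by (simp add: g_simps o x g\<zeta> \<eta>x)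
  qed
qed

lemma has_signature_gt_S: "has_signature gt S (dim S div 2) (dim S div 2)"
  by (rule has_signature_gt_invariant[OF S(1) S_invariant \<eta>_S S(3)])

text \<open>\<open>\<phi> s\<close> stays in \<open>S\<close>, hence in \<open>T\<close>, to which
  the radical is \<open>g\<close>-orthogonal; the \<open>\<eta>\<close> term vanishes on
  \<open>S\<close>.\<close>

lemma gt_R_S:
  assumes "x \<in> R" "s \<in> S"
  shows "gt x s = 0"
proof -
  have "\<phi> s \<in> T"
    using S_invariant[OF assms(2)] S_subset_T by blast
  then have "g x (\<phi> s) = 0"
    using assms(1) unfolding R by blast
  then show ?thesis
    by (simp add: gt_def \<eta>_S[OF assms(2)])
qed

text \<open>\<open>\<phi> \<xi>\<close> is a multiple of \<open>L\<close> and thus orthogonal to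
  \<open>\<xi>\<close>, so only the \<open>\<eta>\<close> term survives:
  \<open>gt \<xi> \<xi> = \<mu>^2\<close>. A \<open>g\<close>-null line becomes spacelike.\<close>

lemma gt_R_pos:
  assumes "x \<in> R" "x \<noteq> 0"
  shows "gt x x > 0"
proof -
  obtain \<xi> N L \<mu> where F: "adapted_frame \<xi> N L \<mu>" using adapted_frame_exists by blast
  then have F': "frame \<xi> N L" and \<mu>: "\<phi> \<xi> = \<mu> *\<^sub>R L" "\<mu> \<noteq> 0" "\<eta> \<xi> = \<mu>"
    unfolding adapted_frame_def by auto
  obtain k where k: "x = k *\<^sub>R \<xi>"
    using subspace_dim_1_scale[OF subspace_R dim_R _ _ assms(1)] F' unfolding frame_def by metis
  have "gt x x = (k * \<mu>)\<^sup>2"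
    by (simp add: k gt_def g_simps \<phi>_simps \<eta>_simps \<mu> frame_orthogonality[OF F'] power2_eq_square)
  then show ?thesis
    using assms(2) k \<mu>(2) by auto
qed

lemma gt_orthogonal_direct_sum: "orthogonal_direct_sum gt S R T"
proof -
  have "{v + w |v w. v \<in> S \<and> w \<in> R} = {v + w |v w. v \<in> R \<and> w \<in> S}"
    by (auto; metis add.commute)
  moreover have "gt s x = 0" if "s \<in> S" "x \<in> R" for s x
    using gt_R_S[OF that(2,1)] gt_sym[of s x] by simp
  ultimately show ?thesis
    using T_sum unfolding orthogonal_direct_sum_def by (simp add: Int_commute)
qed

lemma has_signature_gt_R: "has_signature gt R 1 0"
proof -
  obtain \<xi> N L where F: "frame \<xi> N L" using frame_exists by blast
  then have \<xi>: "\<xi> \<in> R" "\<xi> \<noteq> 0" by (auto simp: frame_def)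
  define e where "e = (1 / sqrt (gt \<xi> \<xi>)) *\<^sub>R \<xi>"
  have "gt e e = 1"
    using gt_R_pos[OF \<xi>] by (simp add: e_def gt_simps)
  moreover have e: "e \<in> R" "e \<noteq> 0"
    using \<xi> gt_R_pos[OF \<xi>] subspace_R by (auto simp: e_def subspace_scale)
  moreover have "span {e} = span R"
    using e dim_R by (intro dim_eq_span) auto
  then have "span {e} = R"
    using subspace_R by (simp add: span_eq_iff)
  ultimately show ?thesis
    by (intro has_signatureI[where P = "{e}" and Q = "{}"] bilinear_gt) auto
qed

lemma has_signature_gt_T: "has_signature gt T (Suc (dim S div 2)) (dim S div 2)"
proof -
  obtain e where e: "gt e e = 1" "R = span {e}"
    using has_signature_gt_R by (rule has_signatureE) (auto simp: card_Suc_eq)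
  have "e \<in> R" by (simp add: e span_base)
  have "T = span (insert e S)"
  proof
    show "T \<subseteq> span (insert e S)"
      using T_sum unfolding orthogonal_direct_sum_def e
      by (auto intro!: span_add intro: span_base subsetD[OF span_mono])
    show "span (insert e S) \<subseteq> T"
      using T S_subset_T \<open>e \<in> R\<close> by (intro span_minimal) (auto simp: R)
  qed
  then show ?thesis
    using gt_R_S[OF \<open>e \<in> R\<close>] gt_sym e(1)
    by (intro has_signature_insert_pos[OF bilinear_gt has_signature_gt_S]) auto
qed

text \<open>All products reduce to \<open>gt\<close> on the plane of \<open>\<xi>\<close> and
  \<open>L\<close>, together with the duality of \<open>\<zeta>\<close> and \<open>\<eta>\<close>.
  That \<open>N1\<close> and \<open>N2\<close> exhaust the normal space is deduced from
  nondegeneracy: a normal vector minus its projection to their plane is orthogonal to a spanning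
  set.\<close>

lemma gt_normal_frame:
  assumes F: "adapted_frame \<xi> N L \<mu>"
  defines "N1 \<equiv> \<zeta> - L" and "N2 \<equiv> 2 *\<^sub>R \<zeta> - (2 * \<mu>) *\<^sub>R N - L"
  shows "gt N1 N1 = 1" "gt N2 N2 = -1" "gt N1 N2 = 0"
    "N1 \<noteq> N2" "independent {N1, N2}" "span {N1, N2} = {v. \<forall>w\<in>T. gt v w = 0}"
proof -
  have F': "frame \<xi> N L" and \<mu>: "\<phi> \<xi> = \<mu> *\<^sub>R L" "\<mu> \<noteq> 0" "\<eta> \<xi> = \<mu>"
    using F unfolding adapted_frame_def by auto
  note o = frame_orthogonality[OF F'] and r = adapted_frame_relations[OF F]
  have "2 *\<^sub>R \<zeta> - (2 * \<mu>) *\<^sub>R N = (1 / \<mu>) *\<^sub>R \<xi>"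
    by (subst r(3)) (simp add: algebra_simps)
  then have N2: "N2 = (1 / \<mu>) *\<^sub>R \<xi> - L"
    by (simp add: N2_def)
  have gt: "gt \<xi> \<xi> = \<mu>\<^sup>2" "gt \<xi> L = \<mu>" "gt L \<xi> = \<mu>" "gt L L = 0"
    using gt_sym[of \<xi> L] by (simp_all add: gt_def \<mu> r(1,2,4) g_simps o g\<zeta> power2_eq_square)
  show 11: "gt N1 N1 = 1" and 22: "gt N2 N2 = -1" and 12: "gt N1 N2 = 0"
    using \<mu>(2) by (simp_all add: N1_def N2 gt_simps gt gt_\<zeta> \<eta>\<zeta> \<eta>_simps r(2) \<mu>(3) power2_eq_square)
  have 21: "gt N2 N1 = 0" using 12 gt_sym by metis
  show ne: "N1 \<noteq> N2" using 11 12 by auto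
  show "independent {N1, N2}"
    by (rule independent_pairwise_orthogonal[OF bilinear_gt]) (use 11 12 22 21 in auto)
  have T_decomp: "\<exists>a s. s \<in> S \<and> w = a *\<^sub>R \<xi> + s" if "w \<in> T" for w
  proof -
    have "w \<in> {v + w |v w. v \<in> R \<and> w \<in> S}"
      using T_sum that unfolding orthogonal_direct_sum_def by simp
    then obtain x s where xs: "w = x + s" "x \<in> R" "s \<in> S"
      by blast
    have "\<xi> \<in> R" "\<xi> \<noteq> 0" using F' unfolding frame_def by auto
    then obtain a where "x = a *\<^sub>R \<xi>"
      using subspace_dim_1_scale[OF subspace_R dim_R] xs(2) by metis
    with xs show ?thesis by blast
  qed
  have "\<xi> \<in> R" using F' unfolding frame_def by blast
  then have \<xi>T: "\<xi> \<in> T" unfolding R by blast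
  have 1: "gt N1 w = 0" and 2: "gt N2 w = 0" if w: "w \<in> T" for w
  proof -
    obtain a s where w: "w = a *\<^sub>R \<xi> + s" "s \<in> S" using T_decomp[OF w] by blast
    have "gt L s = 0" "gt \<xi> s = 0"
      using w(2) S_invariant[OF w(2)] by (simp_all add: gt_def o \<eta>_S)
    then show "gt N1 w = 0" "gt N2 w = 0"
      using \<mu>(2) w(2) by (simp_all add: w(1) N1_def N2 gt_simps gt gt_\<zeta> \<mu>(3) \<eta>_S power2_eq_square)
  qed
  \<comment> \<open>The frame is recovered backwards: \<open>L\<close> from \<open>\<xi>\<close> and
    \<open>N2\<close>, then \<open>\<zeta>\<close> from \<open>N1\<close> and \<open>L\<close>, and
    finally \<open>N\<close> from \<open>\<zeta>\<close> and \<open>\<xi>\<close>.\<close>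
  have spanT: "y \<in> span (T \<union> {N1, N2})" for y
  proof -
    let ?W = "span (T \<union> {N1, N2})"
    have m: "\<xi> \<in> ?W" "N1 \<in> ?W" "N2 \<in> ?W" "\<And>s. s \<in> S \<Longrightarrow> s \<in> ?W"
      using \<xi>T S_subset_T by (auto intro: span_base)
    have "L = (1 / \<mu>) *\<^sub>R \<xi> - N2" by (simp add: N2)
    then have L: "L \<in> ?W" using m by (metis span_diff span_scale)
    have "\<zeta> = N1 + L" by (simp add: N1_def)
    then have \<zeta>: "\<zeta> \<in> ?W" using L m by (metis span_add)
    have "N = (1 / \<mu>) *\<^sub>R (\<zeta> - (1 / (2 * \<mu>)) *\<^sub>R \<xi>)"
      using \<mu>(2) by (subst r(3)) simp
    then have N: "N \<in> ?W" using \<zeta> m by (metis span_diff span_scale)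
    obtain a b c s where "s \<in> S" "y = a *\<^sub>R \<xi> + b *\<^sub>R N + c *\<^sub>R L + s"
      using frame_decomposition[OF F'] .
    then show ?thesis using m L N by (simp add: span_add span_scale)
  qed
  show "span {N1, N2} = {v. \<forall>w\<in>T. gt v w = 0}"
  proof
    have "subspace {v. \<forall>w\<in>T. gt v w = 0}"
      unfolding subspace_def by (simp add: gt_simps)
    then show "span {N1, N2} \<subseteq> {v. \<forall>w\<in>T. gt v w = 0}"
      using 1 2 by (intro span_minimal) auto
    show "{v. \<forall>w\<in>T. gt v w = 0} \<subseteq> span {N1, N2}"
    proof
      fix v assume v: "v \<in> {v. \<forall>w\<in>T. gt v w = 0}"
      \<comment> \<open>Plus sign at \<open>N2\<close> because \<open>gt N2 N2 = -1\<close>.\<close>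
      define x where "x = v - gt v N1 *\<^sub>R N1 + gt v N2 *\<^sub>R N2"
      have base: "gt x y = 0" if "y \<in> T \<union> {N1, N2}" for y
        using that v 1 2 11 12 21 22 by (auto simp: x_def gt_simps)
      have "gt x y = 0" for y
        using spanT[of y]
      proof (induction rule: span_induct_alt)
        case (step c y z)
        then show ?case using base by (simp add: gt_simps)
      qed (simp add: gt_simps)
      then have "g x (\<phi> y) + \<eta> x * \<eta> y = 0" for y
        unfolding gt_def .
      note gx = this
      \<comment> \<open>Nondegeneracy of \<open>gt\<close> is drawn from that of \<open>g\<close>:
        testing with \<open>\<zeta>\<close> gives \<open>\<eta> x = 0\<close>, and testing with
        \<open>\<phi> y\<close> then gives \<open>g x y = 0\<close>.\<close>
      have "\<eta> x = 0" using gx[of \<zeta>] by (simp add: \<phi>\<zeta> \<eta>\<zeta> g_simps)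
      then have "g x y = 0" for y
        using gx[of "\<phi> y"] by (simp add: \<phi>\<phi> \<eta>\<phi> g_simps g\<zeta>)
      then have "x = 0" using nondeg unfolding nondegenerate_on_def by blast
      then have "v = gt v N1 *\<^sub>R N1 - gt v N2 *\<^sub>R N2"
        by (simp add: x_def algebra_simps)
      then show "v \<in> span {N1, N2}"
        by (metis insertI1 insertI2 span_base span_diff span_scale)
    qed
  qed
qed

end

section \<open>Smooth maps between Euclidean spaces\<close>

lemma Ck_on_subset: "Ck_on k S f \<Longrightarrow> T \<subseteq> S \<Longrightarrow> Ck_on k T f"
proof (induction k arbitrary: f)
  case 0
  then show ?case by (auto intro: continuous_on_subset)
next
  case (Suc k)
  then show ?case by auto
qed

text \<open>Openness is essential: the derivatives in \<open>Ck_on\<close> are full ones, so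
  agreement on \<open>S\<close> only determines them where \<open>S\<close> contains a
  neighbourhood.\<close>

lemma Ck_on_cong:
  assumes "open S" "\<And>x. x \<in> S \<Longrightarrow> f x = h x" "Ck_on k S f"
  shows "Ck_on k S h"
  using assms(2,3)
proof (induction k arbitrary: f h)
  case 0
  then show ?case by (simp cong: continuous_on_cong)
next
  case (Suc k)
  have d: "(h has_derivative frechet_derivative f (at x)) (at x)" if "x \<in> S" for x
    using that Suc.prems assms(1)
    by (intro has_derivative_transform_within_open[of f _ x UNIV S h])
       (auto simp: frechet_derivative_works)
  have "Ck_on k S (\<lambda>x. frechet_derivative h (at x) v)" for v
  proof (rule Suc.IH)
    show "frechet_derivative f (at x) v = frechet_derivative h (at x) v" if "x \<in> S" for x
      using frechet_derivative_at[OF d[OF that]] by simp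
    show "Ck_on k S (\<lambda>x. frechet_derivative f (at x) v)"
      using Suc.prems by simp
  qed
  then show ?case
    using d by (auto simp: differentiable_def)
qed

text \<open>Lets the inductions below use an explicit derivative in place of
  \<open>frechet_derivative\<close>.\<close>

lemma Ck_on_SucI:
  assumes "open S" "\<And>x. x \<in> S \<Longrightarrow> (f has_derivative f' x) (at x)" "\<And>v. Ck_on k S (\<lambda>x. f' x v)"
  shows "Ck_on (Suc k) S f"
proof -
  have "Ck_on k S (\<lambda>x. frechet_derivative f (at x) v)" for v
    by (rule Ck_on_cong[OF assms(1) _ assms(3)[of v]]) (simp add: frechet_derivative_at[OF assms(2), symmetric])
  then show ?thesis
    using assms(2) by (auto simp: differentiable_def)
qed

lemma Ck_on_Suc_has_derivative:
  "Ck_on (Suc k) S f \<Longrightarrow> x \<in> S \<Longrightarrow> (f has_derivative frechet_derivative f (at x)) (at x)"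
  by (simp add: frechet_derivative_works)

lemma Ck_on_lower: "Ck_on (Suc k) S f \<Longrightarrow> Ck_on k S f"
proof (induction k arbitrary: f)
  case 0
  then show ?case
    by (auto intro!: continuous_at_imp_continuous_on differentiable_imp_continuous_within)
next
  case (Suc k)
  then show ?case by auto
qed

lemma Ck_on_const: "open S \<Longrightarrow> Ck_on k S (\<lambda>x. c)"
proof (induction k arbitrary: c)
  case (Suc k)
  then show ?case by (intro Ck_on_SucI[where f' = "\<lambda>_ _. 0"]) auto
qed simp

lemma Ck_on_bounded_linear:
  assumes "bounded_linear h" "open S" "Ck_on k S f"
  shows "Ck_on k S (\<lambda>x. h (f x))"
  using assms(3)
proof (induction k arbitrary: f)
  case 0
  then show ?case
    using assms(1) by (auto intro: bounded_linear.continuous_on)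
next
  case (Suc k)
  show ?case
  proof (rule Ck_on_SucI[OF assms(2)])
    show "((\<lambda>x. h (f x)) has_derivative (\<lambda>v. h (frechet_derivative f (at x) v))) (at x)" if "x \<in> S" for x
      by (rule bounded_linear.has_derivative[OF assms(1) Ck_on_Suc_has_derivative[OF Suc.prems that]])
    show "Ck_on k S (\<lambda>x. h (frechet_derivative f (at x) v))" for v
      using Suc.prems by (intro Suc.IH) simp
  qed
qed

lemma Ck_on_add:
  assumes "open S" "Ck_on k S f" "Ck_on k S h"
  shows "Ck_on k S (\<lambda>x. f x + h x)"
  using assms(2,3)
proof (induction k arbitrary: f h)
  case 0
  then show ?case by (auto intro: continuous_on_add)
next
  case (Suc k)
  show ?case
  proof (rule Ck_on_SucI[OF assms(1)])
    show "((\<lambda>x. f x + h x) has_derivative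
        (\<lambda>v. frechet_derivative f (at x) v + frechet_derivative h (at x) v)) (at x)" if "x \<in> S" for x
      using Suc.prems[THEN Ck_on_Suc_has_derivative, OF that] by (rule has_derivative_add)
    show "Ck_on k S (\<lambda>x. frechet_derivative f (at x) v + frechet_derivative h (at x) v)" for v
      using Suc.prems by (intro Suc.IH) simp_all
  qed
qed

lemma Ck_on_scaleR:
  fixes f :: "'a::euclidean_space \<Rightarrow> real"
  assumes "open S" "Ck_on k S f" "Ck_on k S h"
  shows "Ck_on k S (\<lambda>x. f x *\<^sub>R h x)"
  using assms(2,3)
proof (induction k arbitrary: f h)
  case 0
  then show ?case by (auto intro: continuous_on_scaleR)
next
  case (Suc k)
  show ?case
  proof (rule Ck_on_SucI[OF assms(1)])
    fix x assume "x \<in> S"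
    then show "((\<lambda>x. f x *\<^sub>R h x) has_derivative
        (\<lambda>v. f x *\<^sub>R frechet_derivative h (at x) v + frechet_derivative f (at x) v *\<^sub>R h x)) (at x)"
      using Suc.prems by (intro has_derivative_scaleR Ck_on_Suc_has_derivative) auto
  next
    fix v
    \<comment> \<open>Each summand pairs a derivative with an undifferentiated factor, whose class
      must be lowered from \<open>Suc k\<close> to \<open>k\<close> before the induction hypothesis
      applies.\<close>
    show "Ck_on k S (\<lambda>x. f x *\<^sub>R frechet_derivative h (at x) v + frechet_derivative f (at x) v *\<^sub>R h x)"
      by (intro Ck_on_add assms(1) Suc.IH Suc.prems[THEN Ck_on_lower])
         (use Suc.prems in simp_all)
  qed
qed

lemma Ck_on_sum:
  assumes "open S" "\<And>i. i \<in> I \<Longrightarrow> Ck_on k S (f i)"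
  shows "Ck_on k S (\<lambda>x. \<Sum>i\<in>I. f i x)"
  using assms(2)
proof (induction I rule: infinite_finite_induct)
  case (insert i I)
  then have "Ck_on k S (\<lambda>x. f i x + (\<Sum>i\<in>I. f i x))"
    by (intro Ck_on_add[OF assms(1)]) auto
  with insert.hyps show ?case by simp
qed (simp_all add: Ck_on_const[OF assms(1)])

text \<open>In the chain rule \<open>x\<close> enters both the base point and the argument of the
  derivative of \<open>h\<close>. Expanding the argument in the basis separates them: scalar
  components of the derivative of \<open>f\<close> times partial derivatives of \<open>h\<close>
  composed with the same \<open>f\<close>. Hence the induction generalises over \<open>h\<close>
  alone.\<close>

lemma Ck_on_compose:
  fixes h :: "'b::euclidean_space \<Rightarrow> 'c::real_normed_vector"
  assumes "open S" "open T" "f ` S \<subseteq> T" "Ck_on k T h" "Ck_on k S f"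
  shows "Ck_on k S (h \<circ> f)"
  using assms(4,5)
proof (induction k arbitrary: h)
  case 0
  then show ?case
    using assms(3) by (auto simp: o_def intro: continuous_on_compose2)
next
  case (Suc k)
  have T: "f x \<in> T" if "x \<in> S" for x using that assms(3) by blast
  show ?case
  proof (rule Ck_on_SucI[OF assms(1)])
    fix x assume x: "x \<in> S"
    have "((h \<circ> f) has_derivative frechet_derivative h (at (f x)) \<circ> frechet_derivative f (at x)) (at x)"
      by (intro diff_chain_at Ck_on_Suc_has_derivative[OF Suc.prems(1)]
          Ck_on_Suc_has_derivative[OF Suc.prems(2)] x T)
    moreover have "frechet_derivative h (at (f x)) \<circ> frechet_derivative f (at x) =
       (\<lambda>v. \<Sum>i\<in>Basis. (frechet_derivative f (at x) v \<bullet> i) *\<^sub>R frechet_derivative h (at (f x)) i)"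
    proof
      fix v
      have lin: "linear (frechet_derivative h (at (f x)))"
        using Ck_on_Suc_has_derivative[OF Suc.prems(1) T[OF x]] has_derivative_linear by blast
      have "frechet_derivative h (at (f x)) (\<Sum>i\<in>Basis. (frechet_derivative f (at x) v \<bullet> i) *\<^sub>R i) =
          (\<Sum>i\<in>Basis. (frechet_derivative f (at x) v \<bullet> i) *\<^sub>R frechet_derivative h (at (f x)) i)"
        by (simp only: linear_sum[OF lin] linear_cmul[OF lin])
      then show "(frechet_derivative h (at (f x)) \<circ> frechet_derivative f (at x)) v =
          (\<Sum>i\<in>Basis. (frechet_derivative f (at x) v \<bullet> i) *\<^sub>R frechet_derivative h (at (f x)) i)"
        by (simp add: euclidean_representation)
    qed
    ultimately show "((h \<circ> f) has_derivative
        (\<lambda>v. \<Sum>i\<in>Basis. (frechet_derivative f (at x) v \<bullet> i) *\<^sub>R frechet_derivative h (at (f x)) i)) (at x)"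
      by simp
  next
    fix v
    have "Ck_on k S (\<lambda>x. frechet_derivative h (at (f x)) i)" for i
      using Suc.IH[of "\<lambda>y. frechet_derivative h (at y) i"] Suc.prems(1) Ck_on_lower[OF Suc.prems(2)]
      by (simp add: o_def)
    then show "Ck_on k S (\<lambda>x. \<Sum>i\<in>Basis. (frechet_derivative f (at x) v \<bullet> i) *\<^sub>R frechet_derivative h (at (f x)) i)"
      using Suc.prems(2)
      by (intro Ck_on_sum Ck_on_scaleR assms(1) Ck_on_bounded_linear[OF bounded_linear_inner_left]) auto
  qed
qed

lemma Ck_on_local:
  assumes "open S" "\<And>x. x \<in> S \<Longrightarrow> \<exists>U. open U \<and> x \<in> U \<and> Ck_on k (S \<inter> U) f"
  shows "Ck_on k S f"
  using assms(2)
proof (induction k arbitrary: f)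
  case 0
  show ?case
    unfolding Ck_on.simps continuous_on_eq_continuous_at[OF assms(1)]
  proof
    fix x assume x: "x \<in> S"
    then obtain U where "open U" "x \<in> U" "continuous_on (S \<inter> U) f" using 0 by auto
    then show "isCont f x"
      using assms(1) x continuous_on_eq_continuous_at[of "S \<inter> U" f] by auto
  qed
next
  case (Suc k)
  have "f differentiable (at x)" if "x \<in> S" for x
    using Suc.prems[OF that] that by auto
  moreover have "Ck_on k S (\<lambda>x. frechet_derivative f (at x) v)" for v
    using Suc.prems by (intro Suc.IH) fastforce
  ultimately show ?case by simp
qed

section \<open>Passage from finite differentiability classes to smooth maps\<close>

lemma smooth_onI: "(\<And>k. Ck_on k S f) \<Longrightarrow> smooth_on S f"
  by (simp add: smooth_on_def)

lemma smooth_onD: "smooth_on S f \<Longrightarrow> Ck_on k S f"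
  by (simp add: smooth_on_def)

lemma smooth_on_subset: "smooth_on S f \<Longrightarrow> T \<subseteq> S \<Longrightarrow> smooth_on T f"
  by (rule smooth_onI, rule Ck_on_subset, rule smooth_onD)

lemma smooth_on_cong:
  "open S \<Longrightarrow> (\<And>x. x \<in> S \<Longrightarrow> f x = h x) \<Longrightarrow> smooth_on S f \<Longrightarrow> smooth_on S h"
  by (rule smooth_onI, rule Ck_on_cong[of S f], assumption, assumption, rule smooth_onD)

lemma smooth_on_has_derivative:
  assumes "smooth_on S f" "x \<in> S"
  shows "(f has_derivative frechet_derivative f (at x)) (at x)"
  by (rule Ck_on_Suc_has_derivative[OF smooth_onD[OF assms(1), of "Suc 0"] assms(2)])

lemma smooth_on_frechet_derivative:
  assumes "smooth_on S f"
  shows "smooth_on S (\<lambda>x. frechet_derivative f (at x) v)"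
proof (rule smooth_onI)
  show "Ck_on k S (\<lambda>x. frechet_derivative f (at x) v)" for k
    using smooth_onD[OF assms, of "Suc k"] by simp
qed

lemma smooth_on_const: "open S \<Longrightarrow> smooth_on S (\<lambda>x. c)"
  by (rule smooth_onI, rule Ck_on_const)

lemma smooth_on_bounded_linear:
  "bounded_linear h \<Longrightarrow> open S \<Longrightarrow> smooth_on S f \<Longrightarrow> smooth_on S (\<lambda>x. h (f x))"
  by (rule smooth_onI, rule Ck_on_bounded_linear, assumption, assumption, rule smooth_onD)

lemma smooth_on_add:
  "open S \<Longrightarrow> smooth_on S f \<Longrightarrow> smooth_on S h \<Longrightarrow> smooth_on S (\<lambda>x. f x + h x)"
  by (rule smooth_onI, rule Ck_on_add) (simp_all add: smooth_onD)

lemma smooth_on_scaleR: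
  fixes f :: "'a::euclidean_space \<Rightarrow> real"
  shows "open S \<Longrightarrow> smooth_on S f \<Longrightarrow> smooth_on S h \<Longrightarrow> smooth_on S (\<lambda>x. f x *\<^sub>R h x)"
  by (rule smooth_onI, rule Ck_on_scaleR) (simp_all add: smooth_onD)

lemma smooth_on_sum:
  "open S \<Longrightarrow> (\<And>i. i \<in> I \<Longrightarrow> smooth_on S (f i)) \<Longrightarrow> smooth_on S (\<lambda>x. \<Sum>i\<in>I. f i x)"
  by (rule smooth_onI, rule Ck_on_sum) (simp_all add: smooth_onD)

lemma smooth_on_compose:
  fixes h :: "'b::euclidean_space \<Rightarrow> 'c::real_normed_vector"
  assumes "open S" "open T" "f ` S \<subseteq> T" "smooth_on T h" "smooth_on S f"
  shows "smooth_on S (h \<circ> f)"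
  by (rule smooth_onI, rule Ck_on_compose[OF assms(1-3)]) (simp_all add: smooth_onD assms)

lemma smooth_on_local:
  assumes "open S" "\<And>x. x \<in> S \<Longrightarrow> \<exists>U. open U \<and> x \<in> U \<and> smooth_on (S \<inter> U) f"
  shows "smooth_on S f"
  by (rule smooth_onI, rule Ck_on_local[OF assms(1)]) (meson assms(2) smooth_onD)

lemma smooth_on_componentwise:
  fixes f :: "'a::euclidean_space \<Rightarrow> 'b::euclidean_space"
  assumes "open S"
  shows "smooth_on S f \<longleftrightarrow> (\<forall>i\<in>Basis. smooth_on S (\<lambda>x. f x \<bullet> i))"
proof
  show "smooth_on S f \<Longrightarrow> \<forall>i\<in>Basis. smooth_on S (\<lambda>x. f x \<bullet> i)"
    using assms by (auto intro: smooth_on_bounded_linear[OF bounded_linear_inner_left])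
  assume "\<forall>i\<in>Basis. smooth_on S (\<lambda>x. f x \<bullet> i)"
  then have "smooth_on S (\<lambda>x. \<Sum>i\<in>Basis. (f x \<bullet> i) *\<^sub>R i)"
    using assms by (intro smooth_on_sum smooth_on_scaleR smooth_on_const) auto
  then show "smooth_on S f"
    by (simp add: euclidean_representation)
qed

section \<open>Charts\<close>

lemma chart_inv_left: "is_chart c \<Longrightarrow> p \<in> fst c \<Longrightarrow> chart_inv c (snd c p) = p"
  unfolding is_chart_def homeomorphism_def by blast

lemma chart_image_open:
  assumes "is_chart c" "open U"
  shows "open (snd c ` (fst c \<inter> U))"
proof -
  have "openin (top_of_set (fst c)) (fst c \<inter> U)"
    using assms(2) by (rule openin_open_Int)
  then have "openin (top_of_set (snd c ` fst c)) (snd c ` (fst c \<inter> U))"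
    using assms(1) homeomorphism_imp_open_map unfolding is_chart_def by blast
  then show ?thesis
    using assms(1) unfolding is_chart_def by (auto intro: openin_open_trans)
qed

lemma smooth_atlas_is_chart: "smooth_atlas A \<Longrightarrow> c \<in> A \<Longrightarrow> is_chart c"
  unfolding smooth_atlas_def by blast

lemma smooth_atlas_open: "smooth_atlas A \<Longrightarrow> c \<in> A \<Longrightarrow> open (fst c)"
  using smooth_atlas_is_chart unfolding is_chart_def by blast

lemma chart_at:
  assumes "smooth_atlas A"
  shows "chart_at A p \<in> A" "p \<in> fst (chart_at A p)"
proof -
  have "p \<in> (\<Union>c\<in>A. fst c)"
    using assms unfolding smooth_atlas_def by simp
  then have "\<exists>c. c \<in> A \<and> p \<in> fst c" by blast
  from someI_ex[OF this] show "chart_at A p \<in> A" "p \<in> fst (chart_at A p)"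
    unfolding chart_at_def by auto
qed

lemma smooth_map_id: "smooth_atlas A \<Longrightarrow> smooth_map A A id"
  unfolding smooth_atlas_def smooth_map_def by (simp add: continuous_on_id)

lemma smooth_map_open_vimage: "smooth_map A B f \<Longrightarrow> open V \<Longrightarrow> open (f -` V)"
  unfolding smooth_map_def by (metis continuous_on_open_vimage inf_top_right open_UNIV)

section \<open>Smooth functions\<close>

lemma smooth_scalar_on_subset: "smooth_scalar_on A U h \<Longrightarrow> V \<subseteq> U \<Longrightarrow> smooth_scalar_on A V h"
  unfolding smooth_scalar_on_def by (meson Int_mono image_mono order_refl smooth_on_subset)

context
  fixes A :: "('m::{t2_space,second_countable_topology}, 'e::euclidean_space) chart set"
    and U :: "'m set"
  assumes A: "smooth_atlas A" and U: "open U"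
begin

lemma smooth_scalar_on_cong:
  assumes "smooth_scalar_on A U h" "\<And>p. p \<in> U \<Longrightarrow> h p = k p"
  shows "smooth_scalar_on A U k"
  unfolding smooth_scalar_on_def
proof
  fix c assume c: "c \<in> A"
  show "smooth_on (snd c ` (fst c \<inter> U)) (k \<circ> chart_inv c)"
  proof (rule smooth_on_cong)
    show "open (snd c ` (fst c \<inter> U))"
      using chart_image_open[OF smooth_atlas_is_chart[OF A c] U] .
    show "smooth_on (snd c ` (fst c \<inter> U)) (h \<circ> chart_inv c)"
      using assms(1) c unfolding smooth_scalar_on_def by blast
    show "(h \<circ> chart_inv c) x = (k \<circ> chart_inv c) x" if "x \<in> snd c ` (fst c \<inter> U)" for x
      using that assms(2) by (auto simp: chart_inv_left[OF smooth_atlas_is_chart[OF A c]])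
  qed
qed

lemma smooth_scalar_on_const: "smooth_scalar_on A U (\<lambda>p. k)"
  unfolding smooth_scalar_on_def o_def
  using chart_image_open[OF smooth_atlas_is_chart[OF A] U] by (blast intro: smooth_on_const)

lemma smooth_scalar_on_add:
  "smooth_scalar_on A U h \<Longrightarrow> smooth_scalar_on A U k \<Longrightarrow> smooth_scalar_on A U (\<lambda>p. h p + k p)"
  using chart_image_open[OF smooth_atlas_is_chart[OF A] U] smooth_on_add
  unfolding smooth_scalar_on_def o_def by blast

lemma smooth_scalar_on_mult:
  "smooth_scalar_on A U h \<Longrightarrow> smooth_scalar_on A U k \<Longrightarrow> smooth_scalar_on A U (\<lambda>p. h p * k p)"
  using chart_image_open[OF smooth_atlas_is_chart[OF A] U] smooth_on_scaleR[where 'b = real]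
  unfolding smooth_scalar_on_def o_def real_scaleR_def by blast

lemma smooth_scalar_on_sum:
  "(\<And>i. i \<in> I \<Longrightarrow> smooth_scalar_on A U (h i)) \<Longrightarrow> smooth_scalar_on A U (\<lambda>p. \<Sum>i\<in>I. h i p)"
  by (induction I rule: infinite_finite_induct)
     (simp_all add: smooth_scalar_on_const smooth_scalar_on_add)

lemma smooth_scalar_on_local:
  assumes "\<And>p. p \<in> U \<Longrightarrow> \<exists>V. open V \<and> p \<in> V \<and> smooth_scalar_on A (U \<inter> V) h"
  shows "smooth_scalar_on A U h"
  unfolding smooth_scalar_on_def
proof
  fix c assume c: "c \<in> A"
  note chart = smooth_atlas_is_chart[OF A c]
  show "smooth_on (snd c ` (fst c \<inter> U)) (h \<circ> chart_inv c)"
  proof (rule smooth_on_local[OF chart_image_open[OF chart U]])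
    fix x assume "x \<in> snd c ` (fst c \<inter> U)"
    then obtain p where p: "p \<in> fst c" "p \<in> U" "x = snd c p" by blast
    then obtain V where V: "open V" "p \<in> V" "smooth_scalar_on A (U \<inter> V) h"
      using assms by blast
    let ?W = "snd c ` (fst c \<inter> (U \<inter> V))"
    have "open ?W"
      using V(1) U by (intro chart_image_open[OF chart]) auto
    moreover have "x \<in> ?W"
      using p V(2) by blast
    moreover have "smooth_on ?W (h \<circ> chart_inv c)"
      using V(3) c unfolding smooth_scalar_on_def by blast
    then have "smooth_on (snd c ` (fst c \<inter> U) \<inter> ?W) (h \<circ> chart_inv c)"
      by (rule smooth_on_subset) blast
    ultimately show "\<exists>W. open W \<and> x \<in> W \<and> smooth_on (snd c ` (fst c \<inter> U) \<inter> W) (h \<circ> chart_inv c)"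
      by blast
  qed
qed

end

text \<open>One target chart need not contain the image of \<open>c\<close>, so the claim is checked
  near each point, where the coordinate expression factors through a chart \<open>d\<close> around
  \<open>f p\<close>.\<close>

lemma smooth_scalar_on_pullback:
  fixes f :: "'k::{t2_space,second_countable_topology} \<Rightarrow> 'm::{t2_space,second_countable_topology}"
    and A :: "('k, 'd::euclidean_space) chart set" and B :: "('m, 'e::euclidean_space) chart set"
  assumes A: "smooth_atlas A" and B: "smooth_atlas B" and f: "smooth_map A B f" and V: "open V"
    and h: "smooth_scalar_on B V h"
  shows "smooth_scalar_on A (f -` V) (\<lambda>p. h (f p))"
  unfolding smooth_scalar_on_def
proof
  fix c assume c: "c \<in> A"
  note chart = smooth_atlas_is_chart[OF A c]
  have fV: "open (f -` V)"
    using smooth_map_open_vimage[OF f V] .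
  show "smooth_on (snd c ` (fst c \<inter> f -` V)) ((\<lambda>p. h (f p)) \<circ> chart_inv c)"
  proof (rule smooth_on_local[OF chart_image_open[OF chart fV]])
    fix x assume "x \<in> snd c ` (fst c \<inter> f -` V)"
    then obtain p where p: "p \<in> fst c" "f p \<in> V" "x = snd c p" by blast
    define d where "d = chart_at B (f p)"
    have d: "d \<in> B" "f p \<in> fst d" using chart_at[OF B] by (simp_all add: d_def)
    note chart_d = smooth_atlas_is_chart[OF B d(1)]
    let ?W = "snd c ` (fst c \<inter> f -` (V \<inter> fst d))"
    have W: "open ?W"
      using V smooth_atlas_open[OF B d(1)]
      by (intro chart_image_open[OF chart] smooth_map_open_vimage[OF f]) auto
    have "smooth_on ?W ((h \<circ> chart_inv d) \<circ> (snd d \<circ> f \<circ> chart_inv c))"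
    proof (rule smooth_on_compose[OF W chart_image_open[OF chart_d V]])
      show "(snd d \<circ> f \<circ> chart_inv c) ` ?W \<subseteq> snd d ` (fst d \<inter> V)"
        by (auto simp: chart_inv_left[OF chart])
      show "smooth_on (snd d ` (fst d \<inter> V)) (h \<circ> chart_inv d)"
        using h d unfolding smooth_scalar_on_def by blast
      have "smooth_on (snd c ` (fst c \<inter> f -` fst d)) (snd d \<circ> f \<circ> chart_inv c)"
        using f c d unfolding smooth_map_def by blast
      then show "smooth_on ?W (snd d \<circ> f \<circ> chart_inv c)"
        by (rule smooth_on_subset) auto
    qed
    then have "smooth_on ?W ((\<lambda>p. h (f p)) \<circ> chart_inv c)"
      by (rule smooth_on_cong[OF W, rotated]) (auto simp: chart_inv_left[OF chart] chart_inv_left[OF chart_d])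
    then have "smooth_on (snd c ` (fst c \<inter> f -` V) \<inter> ?W) ((\<lambda>p. h (f p)) \<circ> chart_inv c)"
      by (rule smooth_on_subset) blast
    moreover have "x \<in> ?W" using p d by blast
    ultimately show "\<exists>W. open W \<and> x \<in> W \<and>
        smooth_on (snd c ` (fst c \<inter> f -` V) \<inter> W) ((\<lambda>p. h (f p)) \<circ> chart_inv c)"
      using W by blast
  qed
qed

text \<open>Smoothness is defined by testing all charts; smooth transition maps reduce this to a
  single one.\<close>

lemma smooth_scalar_on_chart:
  fixes A :: "('m::{t2_space,second_countable_topology}, 'e::euclidean_space) chart set"
  assumes A: "smooth_atlas A" and c: "c \<in> A" and U: "open U" "U \<subseteq> fst c"
    and h: "smooth_on (snd c ` U) (h \<circ> chart_inv c)"
  shows "smooth_scalar_on A U h"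
  unfolding smooth_scalar_on_def
proof
  fix d assume d: "d \<in> A"
  note chart_c = smooth_atlas_is_chart[OF A c] and chart_d = smooth_atlas_is_chart[OF A d]
  let ?W = "snd d ` (fst d \<inter> U)"
  have W: "open ?W"
    by (rule chart_image_open[OF chart_d U(1)])
  have "smooth_on ?W ((h \<circ> chart_inv c) \<circ> (snd c \<circ> chart_inv d))"
  proof (rule smooth_on_compose[OF W _ _ h])
    show "open (snd c ` U)"
      using chart_image_open[OF chart_c U(1)] U(2) by (simp add: Int_absorb1)
    show "(snd c \<circ> chart_inv d) ` ?W \<subseteq> snd c ` U"
      by (auto simp: chart_inv_left[OF chart_d])
    have "smooth_on (snd d ` (fst d \<inter> fst c)) (snd c \<circ> chart_inv d)"
      using A c d unfolding smooth_atlas_def by blast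
    then show "smooth_on ?W (snd c \<circ> chart_inv d)"
      using U(2) by (elim smooth_on_subset) auto
  qed
  then show "smooth_on ?W (h \<circ> chart_inv d)"
    using U(2)
    by (elim smooth_on_cong[OF W, rotated]) (auto simp: chart_inv_left[OF chart_c] chart_inv_left[OF chart_d] subset_iff)
qed

section \<open>Differentials\<close>

text \<open>The Jacobian of \<open>f\<close> between two arbitrary charts.
  \<open>tangent_map\<close>, \<open>tan_coord\<close> and \<open>tan_vec\<close> are all instances,
  the last two with \<open>f = id\<close>, so one chain rule relates them.\<close>

definition chart_diff ::
  "('k, 'd::euclidean_space) chart \<Rightarrow> ('m, 'e::euclidean_space) chart \<Rightarrow> ('k \<Rightarrow> 'm) \<Rightarrow> 'k \<Rightarrow> 'd \<Rightarrow> 'e" where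
  "chart_diff c d f p = frechet_derivative (snd d \<circ> f \<circ> chart_inv c) (at (snd c p))"

lemma tangent_map_eq_chart_diff:
  "tangent_map A B f p = chart_diff (chart_at A p) (chart_at B (f p)) f p"
  by (simp add: tangent_map_def chart_diff_def)

lemma tan_coord_eq_chart_diff: "tan_coord A c p = chart_diff (chart_at A p) c id p"
  by (simp add: tan_coord_def chart_diff_def)

lemma tan_vec_eq_chart_diff: "tan_vec A c p = chart_diff c (chart_at A p) id p"
  by (simp add: tan_vec_def chart_diff_def)

lemma chart_diff_has_derivative:
  assumes "smooth_map A B f" "c \<in> A" "d \<in> B" "p \<in> fst c" "f p \<in> fst d"
  shows "((snd d \<circ> f \<circ> chart_inv c) has_derivative chart_diff c d f p) (at (snd c p))"
  unfolding chart_diff_def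
proof (rule smooth_on_has_derivative)
  show "smooth_on (snd c ` (fst c \<inter> f -` fst d)) (snd d \<circ> f \<circ> chart_inv c)"
    using assms unfolding smooth_map_def by blast
qed (use assms in blast)

lemma chart_diff_linear:
  assumes "smooth_map A B f" "c \<in> A" "d \<in> B" "p \<in> fst c" "f p \<in> fst d"
  shows "linear (chart_diff c d f p)"
  using chart_diff_has_derivative[OF assms] has_derivative_linear by blast

text \<open>Near \<open>snd c p\<close> the map \<open>f\<close> stays in the domain of
  \<open>d\<close>, so inserting \<open>d\<close> and its inverse changes nothing and the
  intermediate chart drops out.\<close>

lemma chart_diff_chain:
  fixes A :: "('k::{t2_space,second_countable_topology}, 'd::euclidean_space) chart set"
    and B :: "('m::{t2_space,second_countable_topology}, 'e::euclidean_space) chart set"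
  assumes A: "smooth_atlas A" and B: "smooth_atlas B"
    and f: "smooth_map A B f" and h: "smooth_map B C h"
    and c: "c \<in> A" "p \<in> fst c" and d: "d \<in> B" "f p \<in> fst d" and e: "e \<in> C" "h (f p) \<in> fst e"
  shows "chart_diff d e h (f p) (chart_diff c d f p v) = chart_diff c e (h \<circ> f) p v"
proof -
  note chart_c = smooth_atlas_is_chart[OF A c(1)] and chart_d = smooth_atlas_is_chart[OF B d(1)]
  let ?W = "snd c ` (fst c \<inter> f -` fst d)"
  have W: "open ?W"
    by (intro chart_image_open[OF chart_c] smooth_map_open_vimage[OF f] smooth_atlas_open[OF B d(1)])
  have "(snd d \<circ> f \<circ> chart_inv c) (snd c p) = snd d (f p)"
    using c by (simp add: chart_inv_left[OF chart_c])
  then have "((snd e \<circ> h \<circ> chart_inv d) \<circ> (snd d \<circ> f \<circ> chart_inv c) has_derivative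
      chart_diff d e h (f p) \<circ> chart_diff c d f p) (at (snd c p))"
    using chart_diff_has_derivative[OF f c(1) d(1) c(2) d(2)]
      chart_diff_has_derivative[OF h d(1) e(1) d(2) e(2)]
    by (intro diff_chain_at) simp_all
  then have "((snd e \<circ> (h \<circ> f) \<circ> chart_inv c) has_derivative
      chart_diff d e h (f p) \<circ> chart_diff c d f p) (at (snd c p))"
  proof (rule has_derivative_transform_within_open[OF _ W])
    show "snd c p \<in> ?W" using c d by blast
    show "((snd e \<circ> h \<circ> chart_inv d) \<circ> (snd d \<circ> f \<circ> chart_inv c)) x = (snd e \<circ> (h \<circ> f) \<circ> chart_inv c) x"
      if "x \<in> ?W" for x
      using that by (auto simp: chart_inv_left[OF chart_c] chart_inv_left[OF chart_d])
  qed
  from frechet_derivative_at[OF this] show ?thesis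
    unfolding chart_diff_def by (metis comp_apply)
qed

lemma chart_diff_id:
  assumes c: "is_chart c" "p \<in> fst c"
  shows "chart_diff c c id p v = v"
proof -
  have "((snd c \<circ> id \<circ> chart_inv c) has_derivative (\<lambda>v. v)) (at (snd c p))"
  proof (rule has_derivative_transform_within_open)
    show "((\<lambda>x. x) has_derivative (\<lambda>v. v)) (at (snd c p))" by (rule has_derivative_ident)
    show "open (snd c ` fst c)" using c(1) unfolding is_chart_def by blast
  qed (use c chart_inv_left[OF c(1)] in auto)
  from frechet_derivative_at[OF this] show ?thesis
    unfolding chart_diff_def by metis
qed

lemma tan_coord_linear:
  assumes "smooth_atlas A" "c \<in> A" "p \<in> fst c"
  shows "linear (tan_coord A c p)"
  unfolding tan_coord_eq_chart_diff
  using assms chart_at[OF assms(1)] by (intro chart_diff_linear[OF smooth_map_id]) auto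

lemma tan_vec_linear:
  assumes "smooth_atlas A" "c \<in> A" "p \<in> fst c"
  shows "linear (tan_vec A c p)"
  unfolding tan_vec_eq_chart_diff
  using assms chart_at[OF assms(1)] by (intro chart_diff_linear[OF smooth_map_id]) auto

lemma tan_vec_tan_coord:
  assumes A: "smooth_atlas A" and c: "c \<in> A" "p \<in> fst c"
  shows "tan_vec A c p (tan_coord A c p v) = v"
proof -
  note ca = chart_at[OF A, of p]
  have "chart_diff c (chart_at A p) id (id p) (chart_diff (chart_at A p) c id p v) =
      chart_diff (chart_at A p) (chart_at A p) (id \<circ> id) p v"
    using A c ca by (intro chart_diff_chain[OF A A smooth_map_id smooth_map_id]) auto
  then show ?thesis
    using chart_diff_id[OF smooth_atlas_is_chart[OF A ca(1)] ca(2)]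
    by (simp add: tan_vec_eq_chart_diff tan_coord_eq_chart_diff)
qed

lemma tan_vec_expansion:
  assumes A: "smooth_atlas A" and c: "c \<in> A" "p \<in> fst c"
  shows "v = (\<Sum>i\<in>Basis. (tan_coord A c p v \<bullet> i) *\<^sub>R tan_vec A c p i)"
proof -
  note lin = tan_vec_linear[OF A c]
  have "v = tan_vec A c p (\<Sum>i\<in>Basis. (tan_coord A c p v \<bullet> i) *\<^sub>R i)"
    by (simp add: euclidean_representation tan_vec_tan_coord[OF A c])
  then show ?thesis
    by (simp only: linear_sum[OF lin] linear_cmul[OF lin])
qed

lemma tangent_map_linear:
  assumes "smooth_atlas A" "smooth_atlas B" "smooth_map A B f"
  shows "linear (tangent_map A B f p)"
  unfolding tangent_map_eq_chart_diff
  using assms chart_at[OF assms(1)] chart_at[OF assms(2)] by (intro chart_diff_linear[OF assms(3)]) auto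

text \<open>Both sides are the differential of \<open>f\<close> from \<open>c\<close> to
  \<open>chart_at B (f p)\<close>. The right side shows its dependence on \<open>p\<close> through
  the Jacobian in fixed charts, which is smooth.\<close>

lemma tangent_map_tan_vec:
  fixes A :: "('k::{t2_space,second_countable_topology}, 'd::euclidean_space) chart set"
    and B :: "('m::{t2_space,second_countable_topology}, 'e::euclidean_space) chart set"
  assumes A: "smooth_atlas A" and B: "smooth_atlas B" and f: "smooth_map A B f"
    and c: "c \<in> A" "p \<in> fst c" and d: "d \<in> B" "f p \<in> fst d"
  shows "tangent_map A B f p (tan_vec A c p v) = tan_vec B d (f p) (chart_diff c d f p v)"
proof -
  note ca = chart_at[OF A, of p] and cb = chart_at[OF B, of "f p"]
  have "chart_diff (chart_at A p) (chart_at B (f p)) f (id p) (chart_diff c (chart_at A p) id p v) =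
      chart_diff c (chart_at B (f p)) (f \<circ> id) p v"
    using A c ca cb by (intro chart_diff_chain[OF A A smooth_map_id f]) auto
  moreover have "chart_diff d (chart_at B (f p)) id (f p) (chart_diff c d f p v) =
      chart_diff c (chart_at B (f p)) (id \<circ> f) p v"
    using B c d cb by (intro chart_diff_chain[OF A B f smooth_map_id]) auto
  ultimately show ?thesis
    by (simp add: tan_vec_eq_chart_diff tangent_map_eq_chart_diff)
qed

lemma smooth_scalar_on_chart_diff:
  fixes A :: "('k::{t2_space,second_countable_topology}, 'd::euclidean_space) chart set"
    and B :: "('m::{t2_space,second_countable_topology}, 'e::euclidean_space) chart set"
  assumes A: "smooth_atlas A" and B: "smooth_atlas B" and f: "smooth_map A B f"
    and c: "c \<in> A" and d: "d \<in> B"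
  shows "smooth_scalar_on A (fst c \<inter> f -` fst d) (\<lambda>p. chart_diff c d f p v \<bullet> i)"
proof (rule smooth_scalar_on_chart[OF A c])
  note chart_c = smooth_atlas_is_chart[OF A c]
  show "open (fst c \<inter> f -` fst d)"
    by (intro open_Int smooth_atlas_open[OF A c] smooth_map_open_vimage[OF f] smooth_atlas_open[OF B d])
  let ?W = "snd c ` (fst c \<inter> f -` fst d)"
  have W: "open ?W"
    by (intro chart_image_open[OF chart_c] smooth_map_open_vimage[OF f] smooth_atlas_open[OF B d])
  have "smooth_on ?W (snd d \<circ> f \<circ> chart_inv c)"
    using f c d unfolding smooth_map_def by blast
  then have "smooth_on ?W (\<lambda>x. frechet_derivative (snd d \<circ> f \<circ> chart_inv c) (at x) v \<bullet> i)"
    by (intro smooth_on_bounded_linear[OF bounded_linear_inner_left W] smooth_on_frechet_derivative)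
  then show "smooth_on ?W ((\<lambda>p. chart_diff c d f p v \<bullet> i) \<circ> chart_inv c)"
    by (rule smooth_on_cong[OF W, rotated]) (auto simp: chart_diff_def chart_inv_left[OF chart_c])
qed simp

section \<open>Smooth vector fields and bilinear forms\<close>

text \<open>Reduces closure properties of fields to those of scalar functions.\<close>

lemma smooth_field_along_iff:
  fixes A :: "('k::{t2_space,second_countable_topology}, 'd::euclidean_space) chart set"
    and B :: "('m::{t2_space,second_countable_topology}, 'e::euclidean_space) chart set"
  assumes A: "smooth_atlas A" and B: "smooth_atlas B" and f: "smooth_map A B f" and U: "open U"
  shows "smooth_field_along A B f U X \<longleftrightarrow>
    (\<forall>d\<in>B. \<forall>i\<in>Basis. smooth_scalar_on A (U \<inter> f -` fst d) (\<lambda>p. tan_coord B d (f p) (X p) \<bullet> i))"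
proof -
  have "smooth_on (snd c ` (fst c \<inter> U \<inter> f -` fst d)) ((\<lambda>p. tan_coord B d (f p) (X p)) \<circ> chart_inv c) \<longleftrightarrow>
      (\<forall>i\<in>Basis. smooth_on (snd c ` (fst c \<inter> (U \<inter> f -` fst d)))
         ((\<lambda>p. tan_coord B d (f p) (X p) \<bullet> i) \<circ> chart_inv c))" if "c \<in> A" "d \<in> B" for c d
  proof -
    have "open (snd c ` (fst c \<inter> (U \<inter> f -` fst d)))"
      using that U
      by (intro chart_image_open[OF smooth_atlas_is_chart[OF A]] open_Int
          smooth_map_open_vimage[OF f] smooth_atlas_open[OF B])
    from smooth_on_componentwise[OF this] show ?thesis
      by (simp add: o_def Int_assoc)
  qed
  then show ?thesis
    unfolding smooth_field_along_def smooth_scalar_on_def by blast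
qed

lemma smooth_field_along_add:
  fixes A :: "('k::{t2_space,second_countable_topology}, 'd::euclidean_space) chart set"
    and B :: "('m::{t2_space,second_countable_topology}, 'e::euclidean_space) chart set"
  assumes A: "smooth_atlas A" and B: "smooth_atlas B" and f: "smooth_map A B f" and U: "open U"
    and X: "smooth_field_along A B f U X" and Y: "smooth_field_along A B f U Y"
  shows "smooth_field_along A B f U (\<lambda>p. X p + Y p)"
  unfolding smooth_field_along_iff[OF A B f U]
proof (intro ballI)
  fix d :: "('m, 'e) chart" and i :: 'e assume d: "d \<in> B" and i: "i \<in> Basis"
  have O: "open (U \<inter> f -` fst d)"
    by (intro open_Int U smooth_map_open_vimage[OF f] smooth_atlas_open[OF B d])
  have "smooth_scalar_on A (U \<inter> f -` fst d)
      (\<lambda>p. tan_coord B d (f p) (X p) \<bullet> i + tan_coord B d (f p) (Y p) \<bullet> i)"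
    using X Y d i unfolding smooth_field_along_iff[OF A B f U] by (intro smooth_scalar_on_add[OF A O]) auto
  then show "smooth_scalar_on A (U \<inter> f -` fst d) (\<lambda>p. tan_coord B d (f p) (X p + Y p) \<bullet> i)"
    by (rule smooth_scalar_on_cong[OF A O])
       (simp add: linear_add[OF tan_coord_linear[OF B d]] inner_add_left)
qed

lemma smooth_field_along_scaleR:
  fixes A :: "('k::{t2_space,second_countable_topology}, 'd::euclidean_space) chart set"
    and B :: "('m::{t2_space,second_countable_topology}, 'e::euclidean_space) chart set"
  assumes A: "smooth_atlas A" and B: "smooth_atlas B" and f: "smooth_map A B f" and U: "open U"
    and h: "smooth_scalar_on A U h" and X: "smooth_field_along A B f U X"
  shows "smooth_field_along A B f U (\<lambda>p. h p *\<^sub>R X p)"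
  unfolding smooth_field_along_iff[OF A B f U]
proof (intro ballI)
  fix d :: "('m, 'e) chart" and i :: 'e assume d: "d \<in> B" and i: "i \<in> Basis"
  have O: "open (U \<inter> f -` fst d)"
    by (intro open_Int U smooth_map_open_vimage[OF f] smooth_atlas_open[OF B d])
  have "smooth_scalar_on A (U \<inter> f -` fst d) (\<lambda>p. h p * (tan_coord B d (f p) (X p) \<bullet> i))"
    using X d i smooth_scalar_on_subset[OF h Int_lower1]
    unfolding smooth_field_along_iff[OF A B f U] by (intro smooth_scalar_on_mult[OF A O]) auto
  then show "smooth_scalar_on A (U \<inter> f -` fst d) (\<lambda>p. tan_coord B d (f p) (h p *\<^sub>R X p) \<bullet> i)"
    by (rule smooth_scalar_on_cong[OF A O]) (simp add: linear_cmul[OF tan_coord_linear[OF B d]])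
qed

lemma smooth_field_along_diff:
  fixes A :: "('k::{t2_space,second_countable_topology}, 'd::euclidean_space) chart set"
    and B :: "('m::{t2_space,second_countable_topology}, 'e::euclidean_space) chart set"
  assumes A: "smooth_atlas A" and B: "smooth_atlas B" and f: "smooth_map A B f" and U: "open U"
    and X: "smooth_field_along A B f U X" and Y: "smooth_field_along A B f U Y"
  shows "smooth_field_along A B f U (\<lambda>p. X p - Y p)"
  using smooth_field_along_add[OF A B f U X
      smooth_field_along_scaleR[OF A B f U smooth_scalar_on_const[OF A U, of "-1"] Y]]
  by simp

lemma smooth_vector_field_components:
  assumes B: "smooth_atlas B" and V: "open V" and X: "smooth_vector_field_on B V X"
    and d: "d \<in> B" and i: "i \<in> Basis"
  shows "smooth_scalar_on B (V \<inter> fst d) (\<lambda>p. tan_coord B d p (X p) \<bullet> i)"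
  using X d i
  unfolding smooth_vector_field_on_def smooth_field_along_iff[OF B B smooth_map_id[OF B] V] by auto

lemma smooth_field_along_restrict:
  fixes A :: "('k::{t2_space,second_countable_topology}, 'd::euclidean_space) chart set"
    and B :: "('m::{t2_space,second_countable_topology}, 'e::euclidean_space) chart set"
  assumes A: "smooth_atlas A" and B: "smooth_atlas B" and f: "smooth_map A B f" and U: "open U"
    and Z: "smooth_vector_field_on B UNIV Z"
  shows "smooth_field_along A B f U (\<lambda>p. Z (f p))"
  unfolding smooth_field_along_iff[OF A B f U]
proof (intro ballI)
  fix d :: "('m, 'e) chart" and i :: 'e assume d: "d \<in> B" and i: "i \<in> Basis"
  have "smooth_scalar_on B (fst d) (\<lambda>p. tan_coord B d p (Z p) \<bullet> i)"
    using smooth_vector_field_components[OF B open_UNIV Z d i] by simp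
  from smooth_scalar_on_pullback[OF A B f smooth_atlas_open[OF B d] this]
  show "smooth_scalar_on A (U \<inter> f -` fst d) (\<lambda>p. tan_coord B d (f p) (Z (f p)) \<bullet> i)"
    by (rule smooth_scalar_on_subset) simp
qed

text \<open>Near each point, with a fixed target chart \<open>d\<close>, the coefficients are
  products of two Jacobian entries with the coefficients of \<open>g\<close> pulled back by
  \<open>f\<close>, summed over both indices; this is \<open>?G\<close>.\<close>

lemma smooth_bilinear_form_induced_metric:
  fixes A :: "('k::{t2_space,second_countable_topology}, 'd::euclidean_space) chart set"
    and B :: "('m::{t2_space,second_countable_topology}, 'e::euclidean_space) chart set"
  assumes A: "smooth_atlas A" and B: "smooth_atlas B" and f: "smooth_map A B f"
    and g: "smooth_bilinear_form B g"
  shows "smooth_bilinear_form A (induced_metric A B f g)"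
  unfolding smooth_bilinear_form_def
proof (intro conjI allI ballI)
  have g_bilinear: "bilinear (g q)" for q
    using g unfolding smooth_bilinear_form_def by blast
  show "bilinear (induced_metric A B f g p)" for p
    using g_bilinear[of "f p"] linear_compose[OF tangent_map_linear[OF A B f, of p]]
    unfolding bilinear_def induced_metric_def o_def by blast
  fix c and v w :: 'd assume c: "c \<in> A"
  show "smooth_scalar_on A (fst c) (\<lambda>p. induced_metric A B f g p (tan_vec A c p v) (tan_vec A c p w))"
  proof (rule smooth_scalar_on_local[OF A smooth_atlas_open[OF A c]])
    fix p assume p: "p \<in> fst c"
    define d where "d = chart_at B (f p)"
    have d: "d \<in> B" "f p \<in> fst d" using chart_at[OF B] by (simp_all add: d_def)
    let ?V = "f -` fst d"
    have V: "open ?V"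
      by (intro smooth_map_open_vimage[OF f] smooth_atlas_open[OF B d(1)])
    then have O: "open (fst c \<inter> ?V)"
      by (intro open_Int smooth_atlas_open[OF A c])
    let ?G = "\<lambda>q. \<Sum>i\<in>Basis. \<Sum>j\<in>Basis. (chart_diff c d f q v \<bullet> i) * ((chart_diff c d f q w \<bullet> j) *
        g (f q) (tan_vec B d (f q) i) (tan_vec B d (f q) j))"
    have "smooth_scalar_on A ?V (\<lambda>q. g (f q) (tan_vec B d (f q) i) (tan_vec B d (f q) j))" for i j
      using g d(1) unfolding smooth_bilinear_form_def
      by (intro smooth_scalar_on_pullback[OF A B f smooth_atlas_open[OF B d(1)]]) blast
    then have "smooth_scalar_on A (fst c \<inter> ?V) (\<lambda>q. g (f q) (tan_vec B d (f q) i) (tan_vec B d (f q) j))" for i j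
      by (rule smooth_scalar_on_subset) simp
    then have "smooth_scalar_on A (fst c \<inter> ?V) ?G"
      by (intro smooth_scalar_on_sum[OF A O] smooth_scalar_on_mult[OF A O]
          smooth_scalar_on_chart_diff[OF A B f c d(1)])
    then have "smooth_scalar_on A (fst c \<inter> ?V)
        (\<lambda>p. induced_metric A B f g p (tan_vec A c p v) (tan_vec A c p w))"
    proof (rule smooth_scalar_on_cong[OF A O])
      fix q assume q: "q \<in> fst c \<inter> ?V"
      then have q: "q \<in> fst c" "f q \<in> fst d" by auto
      note lin = tan_vec_linear[OF B d(1) q(2)]
      have exp: "tan_vec B d (f q) x = (\<Sum>i\<in>Basis. (x \<bullet> i) *\<^sub>R tan_vec B d (f q) i)" for x
      proof -
        have "tan_vec B d (f q) (\<Sum>i\<in>Basis. (x \<bullet> i) *\<^sub>R i) = (\<Sum>i\<in>Basis. (x \<bullet> i) *\<^sub>R tan_vec B d (f q) i)"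
          by (simp only: linear_sum[OF lin] linear_cmul[OF lin])
        then show ?thesis by (simp add: euclidean_representation)
      qed
      note gb = g_bilinear[of "f q"]
      have "induced_metric A B f g q (tan_vec A c q v) (tan_vec A c q w) =
          g (f q) (\<Sum>i\<in>Basis. (chart_diff c d f q v \<bullet> i) *\<^sub>R tan_vec B d (f q) i)
            (\<Sum>j\<in>Basis. (chart_diff c d f q w \<bullet> j) *\<^sub>R tan_vec B d (f q) j)"
        unfolding induced_metric_def tangent_map_tan_vec[OF A B f c q(1) d(1) q(2)]
        by (simp flip: exp)
      also have "\<dots> = ?G q"
        by (simp add: bilinear_sum_left[OF gb] bilinear_sum_right[OF gb] bilinear_simps(7,8)[OF gb]
            sum_distrib_left algebra_simps) (rule sum.swap)
      finally show "?G q = induced_metric A B f g q (tan_vec A c q v) (tan_vec A c q w)" ..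
    qed
    then show "\<exists>V. open V \<and> p \<in> V \<and> smooth_scalar_on A (fst c \<inter> V)
        (\<lambda>p. induced_metric A B f g p (tan_vec A c p v) (tan_vec A c p w))"
      using V d(2) by blast
  qed
qed

text \<open>Expanding \<open>\<phi>\<close> of a coordinate field in the coordinate basis of the
  same chart writes the form through components of \<open>\<phi>\<close>, coefficients of
  \<open>g\<close> and values of \<open>\<eta>\<close>, all smooth by assumption.\<close>

lemma smooth_bilinear_form_associated_metric:
  fixes B :: "('m::{t2_space,second_countable_topology}, 'e::euclidean_space) chart set"
  assumes B: "smooth_atlas B" and \<phi>: "smooth_endomorphism B \<phi>" and \<eta>: "smooth_one_form B \<eta>"
    and g: "smooth_bilinear_form B g"
  shows "smooth_bilinear_form B (associated_metric \<phi> \<eta> g)"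
  unfolding smooth_bilinear_form_def
proof (intro conjI allI ballI)
  have gb: "bilinear (g p)" and lin_\<phi>: "linear (\<phi> p)" and lin_\<eta>: "linear (\<eta> p)" for p
    using g \<phi> \<eta> unfolding smooth_bilinear_form_def smooth_endomorphism_def smooth_one_form_def by blast+
  show "bilinear (associated_metric \<phi> \<eta> g p)" for p
    unfolding bilinear_def associated_metric_def
    by (auto intro!: linearI simp: bilinear_simps[OF gb] linear_add[OF lin_\<phi>] linear_add[OF lin_\<eta>]
        linear_cmul[OF lin_\<phi>] linear_cmul[OF lin_\<eta>] algebra_simps)
  fix c and v w :: 'e assume c: "c \<in> B"
  note O = smooth_atlas_open[OF B c]
  let ?E = "\<lambda>p. tan_vec B c p"
  let ?G = "\<lambda>p. (\<Sum>i\<in>Basis. (tan_coord B c p (\<phi> p (?E p w)) \<bullet> i) * g p (?E p v) (?E p i)) +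
      \<eta> p (?E p v) * \<eta> p (?E p w)"
  have "smooth_vector_field_on B (fst c) (\<lambda>p. \<phi> p (?E p w))"
    using \<phi> c unfolding smooth_endomorphism_def by blast
  then have "smooth_scalar_on B (fst c) (\<lambda>p. tan_coord B c p (\<phi> p (?E p w)) \<bullet> i)" if "i \<in> Basis" for i
    using smooth_vector_field_components[OF B O _ c that] by fastforce
  moreover have "smooth_scalar_on B (fst c) (\<lambda>p. g p (?E p x) (?E p y))" for x y
    using g c unfolding smooth_bilinear_form_def by blast
  moreover have "smooth_scalar_on B (fst c) (\<lambda>p. \<eta> p (?E p x))" for x
    using \<eta> c unfolding smooth_one_form_def by blast
  ultimately have "smooth_scalar_on B (fst c) ?G"
    by (intro smooth_scalar_on_add[OF B O] smooth_scalar_on_sum[OF B O] smooth_scalar_on_mult[OF B O])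
  then show "smooth_scalar_on B (fst c) (\<lambda>p. associated_metric \<phi> \<eta> g p (?E p v) (?E p w))"
  proof (rule smooth_scalar_on_cong[OF B O])
    fix p assume p: "p \<in> fst c"
    have "g p (?E p v) (\<phi> p (?E p w)) =
        g p (?E p v) (\<Sum>i\<in>Basis. (tan_coord B c p (\<phi> p (?E p w)) \<bullet> i) *\<^sub>R ?E p i)"
      using tan_vec_expansion[OF B c p] by simp
    then show "?G p = associated_metric \<phi> \<eta> g p (?E p v) (?E p w)"
      by (simp add: associated_metric_def bilinear_sum_right[OF gb] bilinear_simps(8)[OF gb])
  qed
qed

section \<open>Ascreen radical screen transversal half lightlike submanifolds\<close>

lemma almost_contact_B_metric_vector_space:
  assumes "almost_contact_B_metric n B \<phi> \<zeta> \<eta> g"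
  shows "B_metric_vector_space (\<phi> q) (\<zeta> q) (\<eta> q) (g q)"
  using assms
  unfolding almost_contact_B_metric_def B_metric_vector_space_def semi_riemannian_metric_def
    smooth_endomorphism_def smooth_one_form_def smooth_bilinear_form_def
  by blast

lemma associated_metric_eq_gt:
  assumes "B_metric_vector_space (\<phi> q) (\<zeta> q) (\<eta> q) (g q)"
  shows "associated_metric \<phi> \<eta> g q = B_metric_vector_space.gt (\<phi> q) (\<eta> q) (g q)"
  by (intro ext) (simp add: associated_metric_def B_metric_vector_space.gt_def[OF assms])

lemma ascreen_radical_screen_transversal_vector_space:
  fixes B :: "('m::{t2_space,second_countable_topology}, 'e::euclidean_space) chart set"
    and A :: "('k::{t2_space,second_countable_topology}, 'd::euclidean_space) chart set"
  assumes ac: "almost_contact_B_metric n B \<phi> \<zeta> \<eta> g"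
    and rst: "radical_screen_transversal A B f \<phi> g S ST"
    and asc: "ascreen A B f \<zeta> g S ST"
  shows "ascreen_rst_vector_space (\<phi> (f p)) (\<zeta> (f p)) (\<eta> (f p)) (g (f p))
    (tangent_space A B f p) (Rad A B f g p) (S p) (ST p)"
proof -
  have hl: "half_lightlike A B f g S ST" and rst': "\<phi> (f p) ` Rad A B f g p = ST p"
    using rst unfolding radical_screen_transversal_def by auto
  have sub: "submanifold A B f" and dims: "DIM('e) = DIM('d) + 2" and "dim (Rad A B f g p) = 1"
    and S: "smooth_subbundle A B f (DIM('d) - 1) S" and ST: "smooth_subbundle A B f 1 ST"
    and nd: "nondegenerate_on (g (f p)) (S p)"
    and sums: "orthogonal_direct_sum (g (f p)) (Rad A B f g p) (S p) (tangent_space A B f p)"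
      "orthogonal_direct_sum (g (f p)) (Rad A B f g p) (ST p) (normal_bundle_at A B f g p)"
    using hl unfolding half_lightlike_def by auto
  have "linear (tangent_map A B f p)"
    using sub unfolding submanifold_def by (blast intro: tangent_map_linear)
  then have T: "subspace (tangent_space A B f p)"
    unfolding tangent_space_def by (simp add: linear_subspace_image)
  have "subspace (S p)" "dim (S p) = DIM('d) - 1" "subspace (ST p)" "dim (ST p) = 1"
    using S ST unfolding smooth_subbundle_def by auto
  \<comment> \<open>Codimension two plus the rank of the radical; positivity of
    \<open>DIM('d)\<close> keeps the natural subtraction exact.\<close>
  moreover have "dim (S p) + 3 = DIM('e)"
    using dims \<open>dim (S p) = DIM('d) - 1\<close> DIM_positive[where 'a = 'd] by linarith
  moreover have "\<exists>u\<in>Rad A B f g p. \<exists>v\<in>ltr A B f g S ST p. \<zeta> (f p) = u + v"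
    using asc unfolding ascreen_def by blast
  ultimately show ?thesis
    using T rst' nd sums \<open>dim (Rad A B f g p) = 1\<close> almost_contact_B_metric_vector_space[OF ac, of "f p"]
    unfolding ascreen_rst_vector_space_def ascreen_rst_vector_space_axioms_def
      normal_bundle_at_def ltr_def Rad_def
    by blast
qed

theorem theorem1p1:
  fixes n :: nat
    and B :: "('m::{t2_space,second_countable_topology}, 'e::euclidean_space) chart set"
    and A :: "('k::{t2_space,second_countable_topology}, 'd::euclidean_space) chart set"
    and \<phi> :: "'m \<Rightarrow> 'e \<Rightarrow> 'e" and \<zeta> :: "'m \<Rightarrow> 'e" and \<eta> :: "'m \<Rightarrow> 'e \<Rightarrow> real"
    and g gt :: "'m \<Rightarrow> 'e \<Rightarrow> 'e \<Rightarrow> real"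
    and f :: "'k \<Rightarrow> 'm" and S ST :: "'k \<Rightarrow> 'e set"
  assumes "almost_contact_B_metric n B \<phi> \<zeta> \<eta> g"
    and "gt = associated_metric \<phi> \<eta> g"
    and "radical_screen_transversal A B f \<phi> g S ST"
    and "ascreen A B f \<zeta> g S ST"
  shows "(semi_riemannian_submanifold A B f gt \<and> DIM('e) = DIM('d) + 2 \<and>
          (\<forall>U \<xi> N L \<mu>. local_fields A B f \<phi> \<eta> g S ST U \<xi> N L \<mu> \<longrightarrow>
             (let N1 = (\<lambda>p. \<zeta> (f p) - L p);
                  N2 = (\<lambda>p. 2 *\<^sub>R \<zeta> (f p) - (2 * \<mu> p) *\<^sub>R N p - L p)
              in smooth_field_along A B f U N1 \<and> smooth_field_along A B f U N2 \<and>
                 (\<forall>p\<in>U. N1 p \<noteq> N2 p \<and> independent {N1 p, N2 p} \<and>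
                    span {N1 p, N2 p} = normal_bundle_at A B f gt p \<and>
                    gt (f p) (N1 p) (N1 p) = 1 \<and> gt (f p) (N2 p) (N2 p) = -1 \<and>
                    gt (f p) (N1 p) (N2 p) = 0))))
       \<and> (\<forall>p. orthogonal_direct_sum (gt (f p)) (S p) (Rad A B f g p) (tangent_space A B f p) \<and>
            nondegenerate_on (gt (f p)) (S p) \<and> nondegenerate_on (gt (f p)) (Rad A B f g p) \<and>
            (\<forall>v\<in>Rad A B f g p. v \<noteq> 0 \<longrightarrow> gt (f p) v v > 0) \<and>
            has_signature (gt (f p)) (S p) (n - 1) (n - 1))"
proof -
  note ac = assms(1) and rst = assms(3) and asc = assms(4)
  have dim_e: "DIM('e) = 2 * n + 1" and B: "smooth_atlas B" and \<phi>: "smooth_endomorphism B \<phi>"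
    and \<zeta>: "smooth_vector_field_on B UNIV \<zeta>" and \<eta>: "smooth_one_form B \<eta>"
    and g: "semi_riemannian_metric B g"
    using ac unfolding almost_contact_B_metric_def by auto
  have sub: "submanifold A B f" and dim_d: "DIM('e) = DIM('d) + 2"
    using rst unfolding radical_screen_transversal_def half_lightlike_def by auto
  then have A: "smooth_atlas A" and f: "smooth_map A B f" and inj: "\<And>p. inj (tangent_map A B f p)"
    unfolding submanifold_def by auto
  note lin = tangent_map_linear[OF A B f]
  note amb = almost_contact_B_metric_vector_space[OF ac]
  note pt = ascreen_radical_screen_transversal_vector_space[OF ac rst asc]
  have gt: "gt q = B_metric_vector_space.gt (\<phi> q) (\<eta> q) (g q)" for q
    unfolding assms(2) by (rule associated_metric_eq_gt[where g = g, OF amb])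
  have gt_bilinear: "bilinear (gt q)" for q
    unfolding gt by (rule B_metric_vector_space.bilinear_gt[OF amb])
  have gt_sym: "gt q v w = gt q w v" for q v w
    unfolding gt by (rule B_metric_vector_space.gt_sym[OF amb])
  have gt_smooth: "smooth_bilinear_form B gt"
    unfolding assms(2) using B \<phi> \<eta> g
    by (intro smooth_bilinear_form_associated_metric) (auto simp: semi_riemannian_metric_def)
  \<comment> \<open>From \<open>dim (S p) + 3 = 2 * n + 1\<close>, which also forces
    \<open>n\<close> to be at least 1, so \<open>n - 1\<close> is not truncated.\<close>
  have dim_S: "dim (S p) div 2 = n - 1" for p
    using ascreen_rst_vector_space.S(2)[OF pt, of p] dim_e by linarith
  have sig_gt: "has_signature (gt q) UNIV (Suc n) n" for q
    unfolding gt by (rule B_metric_vector_space.has_signature_gt_UNIV[OF amb dim_e])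
  have sig_S: "has_signature (gt (f p)) (S p) (n - 1) (n - 1)" for p
    using ascreen_rst_vector_space.has_signature_gt_S[OF pt, of p] by (simp add: gt dim_S)
  have sig_R: "has_signature (gt (f p)) (Rad A B f g p) 1 0" for p
    using ascreen_rst_vector_space.has_signature_gt_R[OF pt, of p] by (simp add: gt)
  have "has_signature (gt (f p)) (range (tangent_map A B f p)) (Suc (n - 1)) (n - 1)" for p
    using ascreen_rst_vector_space.has_signature_gt_T[OF pt, of p]
    by (simp add: gt dim_S tangent_space_def)
  then have sig_ind: "has_signature (induced_metric A B f gt p) UNIV (Suc (n - 1)) (n - 1)" for p
    using has_signature_pullback[OF gt_bilinear lin inj] by (simp add: induced_metric_def[abs_def])
  have metric_B: "semi_riemannian_metric B gt"
    unfolding semi_riemannian_metric_def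
    using gt_smooth gt_sym sig_gt has_signature_nondegenerate[OF gt_bilinear sig_gt] by blast
  have ind_smooth: "smooth_bilinear_form A (induced_metric A B f gt)"
    by (rule smooth_bilinear_form_induced_metric[OF A B f gt_smooth])
  then have "nondegenerate_on (induced_metric A B f gt p) UNIV" for p
    using has_signature_nondegenerate[OF _ sig_ind] unfolding smooth_bilinear_form_def by blast
  moreover have "induced_metric A B f gt p v w = induced_metric A B f gt p w v" for p v w
    unfolding induced_metric_def by (rule gt_sym)
  ultimately have "semi_riemannian_metric A (induced_metric A B f gt)"
    unfolding semi_riemannian_metric_def using ind_smooth sig_ind by blast
  then have submanifold: "semi_riemannian_submanifold A B f gt"
    unfolding semi_riemannian_submanifold_def using sub metric_B by blast
  have frames: "let N1 = (\<lambda>p. \<zeta> (f p) - L p);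
                  N2 = (\<lambda>p. 2 *\<^sub>R \<zeta> (f p) - (2 * \<mu> p) *\<^sub>R N p - L p)
              in smooth_field_along A B f U N1 \<and> smooth_field_along A B f U N2 \<and>
                 (\<forall>p\<in>U. N1 p \<noteq> N2 p \<and> independent {N1 p, N2 p} \<and>
                    span {N1 p, N2 p} = normal_bundle_at A B f gt p \<and>
                    gt (f p) (N1 p) (N1 p) = 1 \<and> gt (f p) (N2 p) (N2 p) = -1 \<and>
                    gt (f p) (N1 p) (N2 p) = 0)"
    if F: "local_fields A B f \<phi> \<eta> g S ST U \<xi> N L \<mu>" for U \<xi> N L \<mu>
    unfolding Let_def
  proof (intro conjI ballI)
    have U: "open U" and N: "smooth_field_along A B f U N" and L: "smooth_field_along A B f U L"
      and \<mu>: "smooth_scalar_on A U \<mu>"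
      using F unfolding local_fields_def by auto
    note \<zeta>f = smooth_field_along_restrict[OF A B f U \<zeta>]
    show "smooth_field_along A B f U (\<lambda>p. \<zeta> (f p) - L p)"
      by (rule smooth_field_along_diff[OF A B f U \<zeta>f L])
    show "smooth_field_along A B f U (\<lambda>p. 2 *\<^sub>R \<zeta> (f p) - (2 * \<mu> p) *\<^sub>R N p - L p)"
      by (intro smooth_field_along_diff[OF A B f U] smooth_field_along_scaleR[OF A B f U]
          smooth_scalar_on_mult[OF A U] smooth_scalar_on_const[OF A U] \<zeta>f N L \<mu>)
    fix p assume "p \<in> U"
    then have "\<xi> p \<in> Rad A B f g p" "\<xi> p \<noteq> 0" "L p \<in> ST p" "\<bar>g (f p) (L p) (L p)\<bar> = 1"
        "null_transversal (g (f p)) (S p) (\<xi> p) (L p) (N p)"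
        "\<phi> (f p) (\<xi> p) = \<mu> p *\<^sub>R L p" "\<mu> p \<noteq> 0" "\<eta> (f p) (\<xi> p) = \<mu> p"
      using F unfolding local_fields_def by auto
    \<comment> \<open>At each point of \<open>U\<close> the local fields form an adapted frame, so
      the pointwise results apply to exactly the given \<open>N\<close>, \<open>L\<close> and
      \<open>\<mu>\<close>.\<close>
    then have "ascreen_rst_vector_space.adapted_frame (\<phi> (f p)) (\<eta> (f p)) (g (f p))
        (Rad A B f g p) (S p) (ST p) (\<xi> p) (N p) (L p) (\<mu> p)"
      by (simp add: ascreen_rst_vector_space.adapted_frame_def[OF pt]
          ascreen_rst_vector_space.frame_def[OF pt])
    note nf = ascreen_rst_vector_space.gt_normal_frame[OF pt this, folded gt]
    show "gt (f p) (\<zeta> (f p) - L p) (\<zeta> (f p) - L p) = 1"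
      "gt (f p) (2 *\<^sub>R \<zeta> (f p) - (2 * \<mu> p) *\<^sub>R N p - L p) (2 *\<^sub>R \<zeta> (f p) - (2 * \<mu> p) *\<^sub>R N p - L p) = -1"
      "gt (f p) (\<zeta> (f p) - L p) (2 *\<^sub>R \<zeta> (f p) - (2 * \<mu> p) *\<^sub>R N p - L p) = 0"
      "\<zeta> (f p) - L p \<noteq> 2 *\<^sub>R \<zeta> (f p) - (2 * \<mu> p) *\<^sub>R N p - L p"
      "independent {\<zeta> (f p) - L p, 2 *\<^sub>R \<zeta> (f p) - (2 * \<mu> p) *\<^sub>R N p - L p}"
      by (rule nf)+
    show "span {\<zeta> (f p) - L p, 2 *\<^sub>R \<zeta> (f p) - (2 * \<mu> p) *\<^sub>R N p - L p} = normal_bundle_at A B f gt p"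
      unfolding normal_bundle_at_def by (rule nf)
  qed
  have "orthogonal_direct_sum (gt (f p)) (S p) (Rad A B f g p) (tangent_space A B f p)" for p
    unfolding gt by (rule ascreen_rst_vector_space.gt_orthogonal_direct_sum[OF pt])
  moreover have "gt (f p) v v > 0" if "v \<in> Rad A B f g p" "v \<noteq> 0" for p v
    unfolding gt using that by (rule ascreen_rst_vector_space.gt_R_pos[OF pt])
  ultimately show ?thesis
    using submanifold dim_d frames sig_S has_signature_nondegenerate[OF gt_bilinear sig_S]
      has_signature_nondegenerate[OF gt_bilinear sig_R]
    by blast
qed

end
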